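(* There are absolute constants $b,c>0$ such that for every $d\in\mathbb N$ and $s>1/2$ the sampling numbers of the embedding $\mathrm{Id}\colon H^s_{\rm mix}(\mathbb T^d)\to L_\infty(\mathbb T^d)$ satisfy: (i) $$g_{\lfloor bm\log m\rfloor}(\mathrm{Id}\colon H^s_{\rm mix}(\mathbb T^d)\to L_\infty(\mathbb T^d))\lesssim_{s,d}m^{-s+1/2}(\log m)^{s(d-1)},\qquad m\ge2;$$ (ii) $$g_{\lfloor cn\rfloor}(\mathrm{Id}\colon H^s_{\rm mix}(\mathbb T^d)\to L_\infty(\mathbb T^d))\lesssim_{s,d}n^{-s+1/2}(\log n)^{s(d-1)+1/2},\qquad n\ge2.$$
   Context: $\log$ is the natural logarithm; $\lesssim_{s,d}$ means inequality up to a constant depending only on $s$ and $d$. $\mathbb T=[0,2\pi]$ with endpoints identified. For $f\in L_2(\mathbb T^d)$, $c_k(f)=(2\pi)^{-d}\int_{\mathbb T^d}f(x)e^{-ik\cdot x}dx$. $H^s_{\rm mix}(\mathbb T^d)$ is the space of $f\in L_2(\mathbb T^d)$ with finite norm, where the norm is either one of the two equivalent norms $$\Big(\sum_{k\in\mathbb Z^d}|c_k(f)|^2\prod_{j=1}^d(1+|k_j|)^{2s}\Big)^{1/2},\qquad\Big(\sum_{k\in\mathbb Z^d}|c_k(f)|^2\prod_{j=1}^d(1+|k_j|^2)^{s}\Big)^{1/2};$$ for $s>1/2$ its elements are identified with continuous functions. Sampling numbers: $g_n(\mathrm{Id}\colon H\to F):=\inf_{x^1,\dots,x^n}\inf_R\sup_{\|f\|_H\le1}\|f-R(f(x^1),\dots,f(x^n))\|_F$,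 where $x^1,\dots,x^n$ run over $\mathbb T^d$ and $R$ over linear maps $\mathbb C^n\to F$. *)

theory Defs
  imports "HOL-Analysis.Analysis" "HOL-Probability.Essential_Supremum"
begin

text \<open>The dimension \<^term>\<open>d\<close> is quantified inside the theorem, so points of the torus are
  functions in \<^term>\<open>{..<d} \<rightarrow>\<^sub>E {0..2*pi}\<close> (the space of the measure below) and frequencies are
  functions in \<^term>\<open>{..<d} \<rightarrow>\<^sub>E (UNIV :: int set)\<close>. The faces of the closed cube form a null set, so
  identifying opposite faces matters only for pointwise-defined (continuous) functions.\<close>

definition torus :: "nat \<Rightarrow> (nat \<Rightarrow> real) measure" where
  "torus d = (\<Pi>\<^sub>M i\<in>{..<d}. restrict_space lborel {0..2*pi})"

definition torus_eq :: "nat \<Rightarrow> (nat \<Rightarrow> real) \<Rightarrow> (nat \<Rightarrow> real) \<Rightarrow> bool" where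
  "torus_eq d x y \<longleftrightarrow> (\<forall>i<d. x i = y i \<or> {x i, y i} = {0, 2*pi})"

text \<open>A function on the quotient is continuous iff its lift to the cube is; the topology on
  \<^typ>\<open>nat \<Rightarrow> real\<close> is the product topology, which on the cube is the Euclidean one.\<close>

definition torus_continuous :: "nat \<Rightarrow> ((nat \<Rightarrow> real) \<Rightarrow> complex) \<Rightarrow> bool" where
  "torus_continuous d f \<longleftrightarrow>
     continuous_on (space (torus d)) f \<and>
     (\<forall>x\<in>space (torus d). \<forall>y\<in>space (torus d). torus_eq d x y \<longrightarrow> f x = f y)"

definition L2_torus :: "nat \<Rightarrow> ((nat \<Rightarrow> real) \<Rightarrow> complex) set" where
  "L2_torus d = {f \<in> borel_measurable (torus d). integrable (torus d) (\<lambda>x. (cmod (f x))\<^sup>2)}"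

definition fourier_coeff :: "nat \<Rightarrow> ((nat \<Rightarrow> real) \<Rightarrow> complex) \<Rightarrow> (nat \<Rightarrow> int) \<Rightarrow> complex" where
  "fourier_coeff d f k =
     (LINT x|(torus d). f x * exp (- \<i> * complex_of_real (\<Sum>j<d. real_of_int (k j) * x j)))
       / complex_of_real ((2*pi) ^ d)"

text \<open>The univariate weight factors of the two equivalent norms.\<close>

definition mix_weight_abs :: "real \<Rightarrow> int \<Rightarrow> real" where
  "mix_weight_abs s k = (1 + \<bar>real_of_int k\<bar>) powr (2 * s)"

definition mix_weight_sq :: "real \<Rightarrow> int \<Rightarrow> real" where
  "mix_weight_sq s k = (1 + \<bar>real_of_int k\<bar>\<^sup>2) powr s"

definition Hmix_term ::
  "(real \<Rightarrow> int \<Rightarrow> real) \<Rightarrow> nat \<Rightarrow> real \<Rightarrow> ((nat \<Rightarrow> real) \<Rightarrow> complex) \<Rightarrow> (nat \<Rightarrow> int) \<Rightarrow> real" where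
  "Hmix_term w d s f k = (cmod (fourier_coeff d f k))\<^sup>2 * (\<Prod>j<d. w s (k j))"

text \<open>The space consists of the continuous representatives, which exist and are unique for
  \<^term>\<open>s > 1/2\<close>.\<close>

definition Hmix ::
  "(real \<Rightarrow> int \<Rightarrow> real) \<Rightarrow> nat \<Rightarrow> real \<Rightarrow> ((nat \<Rightarrow> real) \<Rightarrow> complex) set" where
  "Hmix w d s = {f \<in> L2_torus d.
     torus_continuous d f \<and> Hmix_term w d s f summable_on ({..<d} \<rightarrow>\<^sub>E UNIV)}"

definition Hmix_norm ::
  "(real \<Rightarrow> int \<Rightarrow> real) \<Rightarrow> nat \<Rightarrow> real \<Rightarrow> ((nat \<Rightarrow> real) \<Rightarrow> complex) \<Rightarrow> real" where
  "Hmix_norm w d s f = sqrt (\<Sum>\<^sub>\<infinity>k\<in>{..<d} \<rightarrow>\<^sub>E UNIV. Hmix_term w d s f k)"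

definition Linf_norm :: "nat \<Rightarrow> ((nat \<Rightarrow> real) \<Rightarrow> complex) \<Rightarrow> ennreal" where
  "Linf_norm d f = esssup (torus d) (\<lambda>x. ennreal (cmod (f x)))"

definition Linf_torus :: "nat \<Rightarrow> ((nat \<Rightarrow> real) \<Rightarrow> complex) set" where
  "Linf_torus d = {f \<in> borel_measurable (torus d). Linf_norm d f < \<infinity>}"

text \<open>\<^term>\<open>Cvec n\<close> is complex n-space, as sequences vanishing from index \<^term>\<open>n\<close> on.
  Linear maps into \<open>L\<^sub>\<infinity>\<close> are given through representatives, so linearity holds up to null sets.\<close>

definition Cvec :: "nat \<Rightarrow> (nat \<Rightarrow> complex) set" where
  "Cvec n = {v. \<forall>i\<ge>n. v i = 0}"

definition linear_to_Linf ::
  "nat \<Rightarrow> nat \<Rightarrow> ((nat \<Rightarrow> complex) \<Rightarrow> (nat \<Rightarrow> real) \<Rightarrow> complex) \<Rightarrow> bool" where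
  "linear_to_Linf d n R \<longleftrightarrow>
     (\<forall>v\<in>Cvec n. R v \<in> Linf_torus d) \<and>
     (\<forall>u\<in>Cvec n. \<forall>v\<in>Cvec n. AE t in torus d. R (\<lambda>i. u i + v i) t = R u t + R v t) \<and>
     (\<forall>a. \<forall>v\<in>Cvec n. AE t in torus d. R (\<lambda>i. a * v i) t = a * R v t)"

definition sample :: "nat \<Rightarrow> (nat \<Rightarrow> nat \<Rightarrow> real) \<Rightarrow> ((nat \<Rightarrow> real) \<Rightarrow> complex) \<Rightarrow> nat \<Rightarrow> complex" where
  "sample n X f = (\<lambda>i. if i < n then f (X i) else 0)"

text \<open>Sampling numbers of the embedding into \<open>L\<^sub>\<infinity>\<close> of a function space \<^term>\<open>H\<close> with norm
  \<^term>\<open>N\<close>.\<close>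

definition sampling_number_Linf ::
  "nat \<Rightarrow> ((nat \<Rightarrow> real) \<Rightarrow> complex) set \<Rightarrow> (((nat \<Rightarrow> real) \<Rightarrow> complex) \<Rightarrow> real) \<Rightarrow> nat \<Rightarrow> ennreal" where
  "sampling_number_Linf d H N n =
     (INF X \<in> {..<n} \<rightarrow> space (torus d). INF R \<in> {R. linear_to_Linf d n R}.
        SUP f \<in> {f \<in> H. N f \<le> 1}. Linf_norm d (\<lambda>t. f t - R (sample n X f) t))"

end

(* The recovery operator is the Smolyak (sparse grid) combination of trigonometric interpolation.
   Let Delta_j be the difference of the interpolation operators with 2^j and 2^(j-1) equidistant
   nodes, and A = sum over j_1 + ... + j_d <= L of the tensor products of Delta_{j_1}, ..., Delta_{j_d}.
   By aliasing, Delta_j maps an exponential of frequency k to a function bounded by 2 that vanishes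
   once 4|k| < 2^j. Hence, with a = s - 1/2, Cauchy-Schwarz on the levels and geometric sums give
     sum over k of w(k)^(-1) |e_k(t) - A e_k(t)|^2 <= C (L+1)^(d-1) 2^(-2aL),
   and Cauchy-Schwarz on the Fourier series bounds the squared uniform error on the unit ball by the
   same quantity. As A uses at most (L+1)^(d-1) 2^(L+1) samples, choosing L maximal within a budget
   of m samples yields the error m^(-a) (log m)^(s(d-1)). This already gives (ii) with c = 1, and (i)
   with b = 2 because 2 m log m >= m. *)

theory Submission
  imports Defs
begin

text \<open>The power of the logarithm dictates how the error is summed. A triangle inequality over
  the level vectors left out would give (L+1)^(d-1) 2^(-aL); with 2^L of order m / L^(d-1) this
  leads to (log m)^((d-1)(a+1)), too much for (i) when d > 1. Keeping squares until the last sum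
  gives (L+1)^((d-1)/2) 2^(-aL) instead, and the exponent becomes (d-1)(a+1/2) = s(d-1). For this
  the sum over the frequencies has to be taken before the sum over the levels.

  The operator reads point values, so the Fourier series must represent f at every point, not just
  almost everywhere. Absolute summability of the coefficients makes the series converge uniformly,
  but that its limit is f needs a uniqueness theorem for continuous functions on the torus, which is
  proved here with concentrating kernels.

  Both norms dominate the one with weight max(1,|k|)^(2s) in each coordinate, so a single argument
  serves both.\<close>

section \<open>Aliasing and trigonometric interpolation in one variable\<close>

text \<open>Trigonometric interpolation in \<open>2 ^ j\<close> equidistant nodes maps the exponential of frequency
  \<open>k\<close> to the one of frequency \<open>alias_freq j k\<close>.\<close>

definition alias_freq :: "nat \<Rightarrow> int \<Rightarrow> int" where
  "alias_freq j k = (k + 2 ^ j div 2) mod 2 ^ j - 2 ^ j div 2"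

definition alias_range :: "nat \<Rightarrow> int set" where
  "alias_range j = {- (2 ^ j div 2) ..< 2 ^ j - 2 ^ j div 2}"

lemma alias_in_range: "alias_freq j k \<in> alias_range j"
proof -
  have "0 \<le> (k + 2 ^ j div 2) mod 2 ^ j" "(k + 2 ^ j div 2) mod 2 ^ j < (2::int) ^ j"
    by auto
  then show ?thesis unfolding alias_freq_def alias_range_def by auto
qed

lemma dvd_diff_alias: "2 ^ j dvd k - alias_freq j k"
proof -
  have "k - alias_freq j k = (k + 2 ^ j div 2) - (k + 2 ^ j div 2) mod 2 ^ j"
    by (simp add: alias_freq_def)
  also have "2 ^ j dvd \<dots>" by (rule dvd_minus_mod)
  finally show ?thesis .
qed

text \<open>\<open>alias_range j\<close> is a window of \<open>2 ^ j\<close> consecutive integers,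
  so two of its members differ by less than \<open>2 ^ j\<close> and are congruent only if
  equal.\<close>

lemma alias_unique:
  assumes "l \<in> alias_range j" "2 ^ j dvd k - l"
  shows "l = alias_freq j k"
proof -
  have "2 ^ j dvd (k - alias_freq j k) - (k - l)"
    using dvd_diff_alias assms(2) by (rule dvd_diff)
  then have "2 ^ j dvd l - alias_freq j k" by simp
  moreover have "\<bar>l - alias_freq j k\<bar> < 2 ^ j"
    using assms(1) alias_in_range[of j k] unfolding alias_range_def by auto
  ultimately show ?thesis
    using zdvd_imp_le[of "2 ^ j" "\<bar>l - alias_freq j k\<bar>"] by (cases "l = alias_freq j k") auto
qed

lemma alias_eq_self:
  assumes "2 * \<bar>k\<bar> < 2 ^ j"
  shows "alias_freq j k = k"
proof -
  have "k \<in> alias_range j"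
  \<comment> \<open>Level 0 is separate because \<open>2 ^ 0 div 2\<close> rounds down to 0: its
    window is {0}.\<close>
  proof (cases j)
    case 0
    with assms show ?thesis by (auto simp: alias_range_def)
  next
    case (Suc n)
    then show ?thesis using assms by (auto simp: alias_range_def)
  qed
  then show ?thesis using alias_unique[of k j k] by simp
qed

text \<open>The value at \<open>t\<close> of the difference operator of level \<open>j\<close>
  applied to the exponential of frequency \<open>k\<close>. Level 0 has no predecessor and is
  interpolation at the single node 0.\<close>

definition level_diff :: "nat \<Rightarrow> int \<Rightarrow> real \<Rightarrow> complex" where
  "level_diff j k t = cis (of_int (alias_freq j k) * t) - (if j = 0 then 0 else cis (of_int (alias_freq (j - 1) k) * t))"

lemma norm_level_diff: "norm (level_diff j k t) \<le> 2"
proof -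
  have "norm (level_diff j k t) \<le> norm (cis (of_int (alias_freq j k) * t)) + norm (if j = 0 then 0 else cis (of_int (alias_freq (j - 1) k) * t))"
    unfolding level_diff_def by (rule norm_triangle_ineq4)
  also have "\<dots> \<le> 2" by auto
  finally show ?thesis .
qed

text \<open>Under this bound the levels \<open>j\<close> and \<open>j - 1\<close> both reproduce the
  exponential; the factor 4 is what the coarser of the two requires.\<close>

lemma level_diff_eq_0:
  assumes "j > 0" "4 * \<bar>k\<bar> < 2 ^ j"
  shows "level_diff j k t = 0"
proof -
  obtain n where n: "j = Suc n" using assms(1) gr0_implies_Suc by blast
  have "alias_freq j k = k" by (rule alias_eq_self) (use assms in linarith)
  moreover have "alias_freq n k = k" by (rule alias_eq_self) (use assms n in auto)
  ultimately show ?thesis by (simp add: level_diff_def n)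
qed

lemma sum_level_diff: "(\<Sum>j\<le>n. level_diff j k t) = cis (of_int (alias_freq n k) * t)"
  by (induction n) (auto simp: level_diff_def)

text \<open>The Lagrange function of node \<open>i\<close> in the span of the exponentials with
  frequencies in \<open>alias_range j\<close>: a Dirichlet-type kernel moved to the node.\<close>

definition node_kernel :: "nat \<Rightarrow> nat \<Rightarrow> real \<Rightarrow> complex" where
  "node_kernel j i t = (\<Sum>l\<in>alias_range j. cis (of_int l * (t - 2 * pi * real i / 2 ^ j))) / 2 ^ j"

text \<open>The summands are the powers of a root of unity \<open>w\<close> with
  \<open>w ^ (2 ^ j) = 1\<close>, so the geometric sum vanishes unless \<open>w = 1\<close>.\<close>

lemma sum_cis_roots:
  fixes z :: int
  shows "(\<Sum>i<2^j. cis (of_int z * (2 * pi * real i / 2 ^ j))) = (if 2 ^ j dvd z then 2 ^ j else 0)"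
proof -
  define w where "w = cis (2 * pi * of_int z / 2 ^ j)"
  have pw: "cis (of_int z * (2 * pi * real i / 2 ^ j)) = w ^ i" for i :: nat
    unfolding w_def Complex.DeMoivre by (simp add: field_simps)
  have w1: "w = 1 \<longleftrightarrow> 2 ^ j dvd z"
  proof
    assume "w = 1"
    then have "cos (2 * pi * of_int z / 2 ^ j) = 1" unfolding w_def by (simp add: complex_eq_iff)
    then obtain n :: int where "2 * pi * of_int z / 2 ^ j = n * 2 * pi"
      by (auto simp: cos_one_2pi_int)
    then have "real_of_int z = real_of_int n * 2 ^ j" by (simp add: field_simps)
    then have "real_of_int z = real_of_int (n * 2 ^ j)" by simp
    then have "z = n * 2 ^ j" by linarith
    then show "2 ^ j dvd z" by simp
  next
    assume "2 ^ j dvd z"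
    then obtain n where "z = 2 ^ j * n" by auto
    then have "w = cis (2 * pi * of_int n)" unfolding w_def by (simp add: mult.assoc del: cis_multiple_2pi)
    then show "w = 1" by (metis cis_multiple_2pi Ints_of_int)
  qed
  have wN: "w ^ (2 ^ j) = 1"
  proof -
    have "w ^ (2 ^ j) = cis (2 * pi * of_int z)"
      unfolding w_def Complex.DeMoivre by (simp add: field_simps)
    then show ?thesis by (simp add: cis_multiple_2pi)
  qed
  show ?thesis
  proof (cases "w = 1")
    case True
    then show ?thesis unfolding pw using w1 by simp
  next
    case False
    have "(\<Sum>i<2^j. w ^ i) = (w ^ (2 ^ j) - 1) / (w - 1)"
      using False by (rule geometric_sum)
    then show ?thesis unfolding pw using w1 False wN by simp
  qed
qed

text \<open>After exchanging the sums, orthogonality of the roots of unity keeps only the one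
  frequency of the window that is congruent to \<open>k\<close>.\<close>

lemma interpolate_cis:
  "(\<Sum>i<2^j. cis (of_int k * (2 * pi * real i / 2 ^ j)) * node_kernel j i t) = cis (of_int (alias_freq j k) * t)"
proof -
  have "(\<Sum>i<2^j. cis (of_int k * (2 * pi * real i / 2 ^ j)) * node_kernel j i t)
     = (\<Sum>i<2^j. \<Sum>l\<in>alias_range j. cis (of_int l * t) * cis (of_int (k - l) * (2 * pi * real i / 2 ^ j)) / 2 ^ j)"
    unfolding node_kernel_def sum_divide_distrib sum_distrib_left
    by (intro sum.cong refl) (simp add: cis_mult field_simps)
  also have "\<dots> = (\<Sum>l\<in>alias_range j. \<Sum>i<2^j. cis (of_int l * t) * cis (of_int (k - l) * (2 * pi * real i / 2 ^ j)) / 2 ^ j)"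
    by (rule sum.swap)
  also have "\<dots> = (\<Sum>l\<in>alias_range j. cis (of_int l * t) * ((\<Sum>i<2^j. cis (of_int (k - l) * (2 * pi * real i / 2 ^ j))) / 2 ^ j))"
    by (simp add: sum_distrib_left sum_divide_distrib)
  also have "\<dots> = (\<Sum>l\<in>alias_range j. if l = alias_freq j k then cis (of_int l * t) else 0)"
  proof (intro sum.cong refl)
    fix l assume l: "l \<in> alias_range j"
    have "(2::int) ^ j dvd k - l \<longleftrightarrow> l = alias_freq j k"
      using alias_unique[OF l] dvd_diff_alias[of j k] by auto
    then show "cis (of_int l * t) * ((\<Sum>i<2^j. cis (of_int (k - l) * (2 * pi * real i / 2 ^ j))) / 2 ^ j)
       = (if l = alias_freq j k then cis (of_int l * t) else 0)"
      using sum_cis_roots[of "k - l" j] by simp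
  qed
  also have "\<dots> = cis (of_int (alias_freq j k) * t)"
    using alias_in_range[of j k] by (simp add: alias_range_def)
  finally show ?thesis .
qed

text \<open>The node \<open>i div 2\<close> of level \<open>j - 1\<close> is the node \<open>i\<close> of level \<open>j\<close> for even \<open>i\<close>, so the
  difference of two consecutive interpolants only samples at the nodes of level \<open>j\<close>.\<close>

definition node_fun :: "nat \<Rightarrow> nat \<Rightarrow> real \<Rightarrow> complex" where
  "node_fun j i t = node_kernel j i t -
     (if j > 0 \<and> even i then node_kernel (j - 1) (i div 2) t else 0)"

lemma sum_node_fun:
  "(\<Sum>i<2^j. cis (of_int k * (2 * pi * real i / 2 ^ j)) * node_fun j i t) = level_diff j k t"
proof (cases j)
  case 0
  then show ?thesis using interpolate_cis[of k 0 t] by (simp add: node_fun_def level_diff_def)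
next
  case (Suc n)
  have "(\<Sum>i<2^j. cis (of_int k * (2 * pi * real i / 2 ^ j)) * (if even i then node_kernel n (i div 2) t else 0))
     = (\<Sum>i\<in>{i. i < 2^j \<and> even i}. cis (of_int k * (2 * pi * real i / 2 ^ j)) * node_kernel n (i div 2) t)"
    by (rule sum.mono_neutral_cong_right) (auto simp: Suc)
  also have "\<dots> = (\<Sum>i<2^n. cis (of_int k * (2 * pi * real i / 2 ^ n)) * node_kernel n i t)"
    by (rule sum.reindex_bij_witness[of _ "\<lambda>i. 2 * i" "\<lambda>i. i div 2"]) (auto simp: Suc mult_ac elim!: evenE)
  also have "\<dots> = cis (of_int (alias_freq n k) * t)" by (rule interpolate_cis)
  finally have "(\<Sum>i<2^j. cis (of_int k * (2 * pi * real i / 2 ^ j)) * (if even i then node_kernel n (i div 2) t else 0))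
     = cis (of_int (alias_freq n k) * t)" .
  moreover have "node_fun j i t = node_kernel j i t - (if even i then node_kernel n (i div 2) t else 0)" for i
    by (simp add: node_fun_def Suc)
  moreover have "level_diff j k t = cis (of_int (alias_freq j k) * t) - cis (of_int (alias_freq n k) * t)"
    by (simp add: level_diff_def Suc)
  ultimately show ?thesis
    using interpolate_cis[where j = j and k = k and t = t] by (simp only: right_diff_distrib sum_subtractf)
qed

lemma continuous_node_fun [continuous_intros]: "continuous_on UNIV (node_fun j i)"
proof -
  have "continuous_on UNIV (node_kernel j i)" for j i
    unfolding node_kernel_def by (intro continuous_intros) simp
  moreover have "node_fun j i = (if j > 0 \<and> even i
      then (\<lambda>t. node_kernel j i t - node_kernel (j - 1) (i div 2) t) else node_kernel j i)"
    by (auto simp: node_fun_def fun_eq_iff)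
  ultimately show ?thesis by (simp add: continuous_on_diff)
qed

section \<open>The sparse grid operator and its action on exponentials\<close>

definition sum_le :: "nat \<Rightarrow> nat \<Rightarrow> (nat \<Rightarrow> nat) set" where
  "sum_le d L = {j \<in> {..<d} \<rightarrow>\<^sub>E {..L}. (\<Sum>l<d. j l) \<le> L}"

text \<open>Infinitely many level vectors are left out by the operator. The cap \<open>n\<close>
  keeps the sum finite; it is later taken so large that the levels up to \<open>n\<close> reproduce
  every frequency at hand.\<close>

definition sum_gt :: "nat \<Rightarrow> nat \<Rightarrow> nat \<Rightarrow> (nat \<Rightarrow> nat) set" where
  "sum_gt d n L = {j \<in> {..<d} \<rightarrow>\<^sub>E {..n}. (\<Sum>l<d. j l) > L}"

definition torus_char :: "nat \<Rightarrow> (nat \<Rightarrow> int) \<Rightarrow> (nat \<Rightarrow> real) \<Rightarrow> complex" where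
  "torus_char d k t = cis (\<Sum>l<d. of_int (k l) * t l)"

text \<open>A pair consists of a level vector and a node of its tensor grid. A point that lies in
  several of these grids is sampled once for each of them.\<close>

definition grid_index :: "nat \<Rightarrow> nat \<Rightarrow> ((nat \<Rightarrow> nat) \<times> (nat \<Rightarrow> nat)) set" where
  "grid_index d L = (SIGMA j:sum_le d L. \<Pi>\<^sub>E l\<in>{..<d}. {..<2 ^ j l})"

definition grid_node :: "nat \<Rightarrow> (nat \<Rightarrow> nat) \<times> (nat \<Rightarrow> nat) \<Rightarrow> nat \<Rightarrow> real" where
  "grid_node d p = (\<lambda>l\<in>{..<d}. 2 * pi * real (snd p l) / 2 ^ fst p l)"

definition grid_fun :: "nat \<Rightarrow> (nat \<Rightarrow> nat) \<times> (nat \<Rightarrow> nat) \<Rightarrow> (nat \<Rightarrow> real) \<Rightarrow> complex" where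
  "grid_fun d p t = (\<Prod>l<d. node_fun (fst p l) (snd p l) (t l))"

definition smolyak :: "nat \<Rightarrow> nat \<Rightarrow> ((nat \<Rightarrow> real) \<Rightarrow> complex) \<Rightarrow> (nat \<Rightarrow> real) \<Rightarrow> complex" where
  "smolyak d L f t = (\<Sum>p\<in>grid_index d L. f (grid_node d p) * grid_fun d p t)"

lemma torus_char_prod: "torus_char d k t = (\<Prod>l<d. cis (of_int (k l) * t l))"
  unfolding torus_char_def by (induction d) (simp_all flip: cis_mult)

lemma norm_torus_char [simp]: "norm (torus_char d k t) = 1"
  by (simp add: torus_char_def)

lemma finite_sum_le [simp]: "finite (sum_le d L)"
  by (simp add: sum_le_def finite_PiE)

lemma finite_sum_gt [simp]: "finite (sum_gt d n L)"
  by (simp add: sum_gt_def finite_PiE)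

lemma finite_grid_index [simp]: "finite (grid_index d L)"
  unfolding grid_index_def by (auto intro!: finite_SigmaI finite_PiE)

lemma smolyak_char:
  "smolyak d L (torus_char d k) t = (\<Sum>j\<in>sum_le d L. \<Prod>l<d. level_diff (j l) (k l) (t l))"
proof -
  have "smolyak d L (torus_char d k) t =
    (\<Sum>j\<in>sum_le d L. \<Sum>i\<in>(\<Pi>\<^sub>E l\<in>{..<d}. {..<2 ^ j l}).
       torus_char d k (grid_node d (j, i)) * grid_fun d (j, i) t)"
    unfolding smolyak_def grid_index_def
    by (subst sum.Sigma) (auto simp: case_prod_unfold intro: finite_PiE)
  also have "\<dots> = (\<Sum>j\<in>sum_le d L. \<Prod>l<d. level_diff (j l) (k l) (t l))"
  proof (intro sum.cong refl)
    fix j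
    have "(\<Sum>i\<in>(\<Pi>\<^sub>E l\<in>{..<d}. {..<2 ^ j l}). torus_char d k (grid_node d (j, i)) * grid_fun d (j, i) t)
      = (\<Sum>i\<in>(\<Pi>\<^sub>E l\<in>{..<d}. {..<2 ^ j l}). \<Prod>l<d.
           cis (of_int (k l) * (2 * pi * real (i l) / 2 ^ j l)) * node_fun (j l) (i l) (t l))"
      by (intro sum.cong refl) (simp add: torus_char_prod grid_fun_def grid_node_def prod.distrib)
    also have "\<dots> = (\<Prod>l<d. \<Sum>i<2 ^ j l. cis (of_int (k l) * (2 * pi * real i / 2 ^ j l)) * node_fun (j l) i (t l))"
      by (rule prod_sum_PiE[symmetric]) auto
    also have "\<dots> = (\<Prod>l<d. level_diff (j l) (k l) (t l))"
      by (simp only: sum_node_fun)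
    finally show "(\<Sum>i\<in>(\<Pi>\<^sub>E l\<in>{..<d}. {..<2 ^ j l}). torus_char d k (grid_node d (j, i)) * grid_fun d (j, i) t)
      = (\<Prod>l<d. level_diff (j l) (k l) (t l))" .
  qed
  finally show ?thesis .
qed

text \<open>By telescoping in each coordinate the exponential is the sum over all level vectors up
  to \<open>n\<close>, once \<open>n\<close> resolves all its frequencies; the operator accounts for
  those of total at most \<open>L\<close>.\<close>

lemma smolyak_error_char:
  assumes "L \<le> n" "\<And>l. l < d \<Longrightarrow> 2 * \<bar>k l\<bar> < 2 ^ n"
  shows "torus_char d k t - smolyak d L (torus_char d k) t
    = (\<Sum>j\<in>sum_gt d n L. \<Prod>l<d. level_diff (j l) (k l) (t l))"
proof -
  let ?g = "\<lambda>j. \<Prod>l<d. level_diff (j l) (k l) (t l)"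
  have "torus_char d k t = (\<Prod>l<d. \<Sum>j\<le>n. level_diff j (k l) (t l))"
    unfolding torus_char_prod sum_level_diff
    by (intro prod.cong refl) (simp add: alias_eq_self assms(2))
  also have "\<dots> = (\<Sum>j\<in>{..<d} \<rightarrow>\<^sub>E {..n}. ?g j)"
    by (rule prod_sum_PiE) auto
  also have "{..<d} \<rightarrow>\<^sub>E {..n} = sum_le d L \<union> sum_gt d n L"
  proof -
    \<comment> \<open>An entry never exceeds the total, so for totals at most \<open>L\<close> the
      caps \<open>L\<close> and \<open>n\<close> select the same vectors.\<close>
    have small: "j \<in> sum_le d L" if "j \<in> {..<d} \<rightarrow>\<^sub>E {..n}" "(\<Sum>l<d. j l) \<le> L" for j
    proof -
      have "j l \<le> L" if "l < d" for l
      proof -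
        have "j l \<le> (\<Sum>l<d. j l)" using that by (intro member_le_sum) simp_all
        then show ?thesis using \<open>(\<Sum>l<d. j l) \<le> L\<close> by linarith
      qed
      then show ?thesis using that by (simp add: sum_le_def PiE_iff)
    qed
    have split: "j \<in> sum_le d L \<or> j \<in> sum_gt d n L" if "j \<in> {..<d} \<rightarrow>\<^sub>E {..n}" for j
      using small[OF that] that unfolding sum_gt_def mem_Collect_eq by linarith
    have le:  "sum_le d L \<subseteq> {..<d} \<rightarrow>\<^sub>E {..n}"
    proof -
      have "{..<d} \<rightarrow>\<^sub>E {..L} \<subseteq> {..<d} \<rightarrow>\<^sub>E {..n}"
        using assms(1) by (intro PiE_mono) auto
      then show ?thesis unfolding sum_le_def by blast
    qed
    have gt: "sum_gt d n L \<subseteq> {..<d} \<rightarrow>\<^sub>E {..n}" unfolding sum_gt_def by blast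
    show ?thesis
      by (rule equalityI[OF subsetI Un_least[OF le gt]]) (use split in simp)
  qed
  also have "(\<Sum>j\<in>\<dots>. ?g j) = (\<Sum>j\<in>sum_le d L. ?g j) + (\<Sum>j\<in>sum_gt d n L. ?g j)"
  proof (rule sum.union_disjoint)
    show "sum_le d L \<inter> sum_gt d n L = {}" unfolding sum_le_def sum_gt_def using leD by blast
  qed simp_all
  finally show ?thesis by (simp add: smolyak_char)
qed

section \<open>Sums over level vectors: grid size and geometric tails\<close>

lemma sum_PiE_lessThan_Suc:
  fixes F :: "(nat \<Rightarrow> 'a) \<Rightarrow> 'b::comm_monoid_add"
  shows "(\<Sum>j\<in>{..<Suc d} \<rightarrow>\<^sub>E A. F j) = (\<Sum>x\<in>A. \<Sum>j\<in>{..<d} \<rightarrow>\<^sub>E A. F (j(d := x)))"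
proof -
  have "(\<Sum>j\<in>{..<Suc d} \<rightarrow>\<^sub>E A. F j) = (\<Sum>(x, j)\<in>A \<times> ({..<d} \<rightarrow>\<^sub>E A). F (j(d := x)))"
    unfolding lessThan_Suc PiE_insert_eq
    using inj_combinator[of d "{..<d}" "\<lambda>_. A"] by (subst sum.reindex) (auto simp: case_prod_unfold)
  then show ?thesis by (simp add: sum.cartesian_product)
qed

text \<open>Peels off one coordinate, which shifts the constraint on the total by \<open>x\<close>.
  The semiring is left open because \<open>r\<close> is the natural number 2 when nodes are counted
  and a real ratio below 1 in the tail estimate.\<close>

lemma sum_weighted_PiE_Suc:
  fixes r :: "'a::comm_semiring_1"
  shows "(\<Sum>j\<in>{..<Suc d} \<rightarrow>\<^sub>E A. if P (\<Sum>l<Suc d. j l) then \<Prod>l<Suc d. r ^ j l else 0) =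
    (\<Sum>x\<in>A. r ^ x * (\<Sum>j\<in>{..<d} \<rightarrow>\<^sub>E A. if P (x + (\<Sum>l<d. j l)) then \<Prod>l<d. r ^ j l else 0))"
  unfolding sum_PiE_lessThan_Suc sum_distrib_left
proof (intro sum.cong refl)
  fix x and j :: "nat \<Rightarrow> nat"
  have "(\<Sum>l<d. (j(d := x)) l) = (\<Sum>l<d. j l)" "(\<Prod>l<d. r ^ (j(d := x)) l) = (\<Prod>l<d. r ^ j l)"
    by (auto intro!: sum.cong prod.cong)
  then show "(if P (\<Sum>l<Suc d. (j(d := x)) l) then \<Prod>l<Suc d. r ^ (j(d := x)) l else 0) =
      r ^ x * (if P (x + (\<Sum>l<d. j l)) then \<Prod>l<d. r ^ j l else 0)"
    unfolding sum.lessThan_Suc prod.lessThan_Suc fun_upd_same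
    by (auto simp only: add.commute[of x] mult.commute[of "r ^ x"] if_True if_False mult_zero_left split: if_split)
qed

text \<open>The constraint on \<open>\<Sum>l<d. j l\<close> is kept as an indicator, so that the recursion in the
  dimension changes the truncation level but not the index set.\<close>

lemma card_grid_index_le:
  assumes "d \<ge> 1"
  shows "card (grid_index d L) \<le> (L + 1) ^ (d - 1) * 2 ^ (L + 1)"
proof -
  let ?S = "\<lambda>d n L. \<Sum>j\<in>{..<d} \<rightarrow>\<^sub>E {..n}. if (\<Sum>l<d. j l) \<le> L then \<Prod>l<d. (2::nat) ^ j l else 0"
  have geo: "(\<Sum>x\<le>n. if x \<le> L then (2::nat) ^ x else 0) \<le> 2 ^ (L + 1)" for n L
  proof -
    have "(\<Sum>x\<le>n. if x \<le> L then (2::nat) ^ x else 0) = (\<Sum>x\<in>{..n} \<inter> {..L}. 2 ^ x)"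
      by (subst sum.inter_restrict) (auto intro!: sum.cong)
    also have "\<dots> \<le> (\<Sum>x\<le>L. 2 ^ x)" by (rule sum_mono2) auto
    also have "\<dots> = 2 ^ (L + 1) - 1" by (induction L) auto
    finally show ?thesis by linarith
  qed
  have S: "?S (Suc d) n L \<le> (L + 1) ^ d * 2 ^ (L + 1)" for d n L
  proof (induction d arbitrary: L)
    case 0
    have "?S (Suc 0) n L = (\<Sum>x\<le>n. if x \<le> L then 2 ^ x else 0)"
      unfolding sum_weighted_PiE_Suc[where P = "\<lambda>s. s \<le> L"]
      by (rule sum.cong[OF refl]) (simp add: PiE_empty_domain)
    then show ?case using geo[of L n] by simp
  next
    case (Suc d)
    \<comment> \<open>For \<open>x > L\<close> no vector meets the constraint, whereas truncated
      subtraction would turn \<open>L - x\<close> into 0; hence the explicit case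
      distinction.\<close>
    have "?S (Suc (Suc d)) n L = (\<Sum>x\<le>n. if x \<le> L then 2 ^ x * ?S (Suc d) n (L - x) else 0)"
      unfolding sum_weighted_PiE_Suc[where d = "Suc d" and P = "\<lambda>s. s \<le> L"]
    proof (rule sum.cong[OF refl])
      fix x
      show "2 ^ x * (\<Sum>j\<in>{..<Suc d} \<rightarrow>\<^sub>E {..n}. if x + (\<Sum>l<Suc d. j l) \<le> L then \<Prod>l<Suc d. 2 ^ j l else 0)
        = (if x \<le> L then 2 ^ x * ?S (Suc d) n (L - x) else 0)"
      proof (cases "x \<le> L")
        case True
        then have "x + s \<le> L \<longleftrightarrow> s \<le> L - x" for s by linarith
        then show ?thesis using True by (simp only: if_True)
      next
        case False
        then have "\<not> x + s \<le> L" for s by linarith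
        then show ?thesis using False by (simp only: if_False sum.neutral_const mult_zero_right)
      qed
    qed
    \<comment> \<open>The factor \<open>2 ^ x\<close> restores what the smaller budget
      \<open>L - x\<close> loses, so every \<open>x \<le> L\<close> receives the same bound.
      Counting these \<open>x\<close> produces one more factor \<open>L + 1\<close>.\<close>
    also have "\<dots> \<le> (\<Sum>x\<le>n. if x \<le> L then (L + 1) ^ d * 2 ^ (L + 1) else 0)"
    proof (rule sum_mono)
      fix x
      have "2 ^ x * ?S (Suc d) n (L - x) \<le> (L + 1) ^ d * 2 ^ (L + 1)" if "x \<le> L"
      proof -
        have "2 ^ x * ?S (Suc d) n (L - x) \<le> 2 ^ x * ((L - x + 1) ^ d * 2 ^ (L - x + 1))"
          by (intro mult_left_mono Suc.IH) auto
        also have "\<dots> = (L - x + 1) ^ d * (2 ^ x * 2 ^ (L - x + 1))" by simp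
        also have "2 ^ x * 2 ^ (L - x + 1) = (2::nat) ^ (L + 1)"
          using that by (simp flip: power_add)
        also have "(L - x + 1) ^ d * 2 ^ (L + 1) \<le> (L + 1) ^ d * 2 ^ (L + 1)"
          by (intro mult_right_mono power_mono) auto
        finally show ?thesis .
      qed
      then show "(if x \<le> L then 2 ^ x * ?S (Suc d) n (L - x) else 0)
          \<le> (if x \<le> L then (L + 1) ^ d * 2 ^ (L + 1) else 0)" by simp
    qed
    also have "\<dots> = card ({..n} \<inter> {..L}) * ((L + 1) ^ d * 2 ^ (L + 1))"
    proof -
      have "(\<Sum>x\<le>n. if x \<le> L then c else 0) = card ({..n} \<inter> {..L}) * c" for c :: nat
      proof -
        have "(\<Sum>x\<le>n. if x \<le> L then c else 0) = (\<Sum>x\<in>{..n} \<inter> {..L}. c)"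
          by (subst sum.inter_restrict) (auto intro!: sum.cong)
        then show ?thesis by simp
      qed
      then show ?thesis .
    qed
    also have "\<dots> \<le> (L + 1) * ((L + 1) ^ d * 2 ^ (L + 1))"
      using card_mono[of "{..L}" "{..n} \<inter> {..L}"] by (intro mult_right_mono) auto
    finally show ?case by (simp only: power_Suc mult.assoc)
  qed
  have "card (grid_index d L) = (\<Sum>j\<in>sum_le d L. card (\<Pi>\<^sub>E l\<in>{..<d}. {..<(2::nat) ^ j l}))"
    unfolding grid_index_def by (rule card_SigmaI) (auto intro!: finite_PiE)
  also have "\<dots> = (\<Sum>j\<in>sum_le d L. \<Prod>l<d. 2 ^ j l)"
    by (simp add: card_PiE)
  also have "\<dots> = ?S d L L"
    unfolding sum_le_def by (rule sum.inter_filter) (auto intro!: finite_PiE)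
  also have "\<dots> \<le> (L + 1) ^ (d - 1) * 2 ^ (L + 1)"
  proof -
    have "Suc (d - 1) = d" using assms by simp
    from S[of "d - 1" L L, unfolded this] show ?thesis .
  qed
  finally show ?thesis .
qed

text \<open>The vectors of total T have weight \<open>r ^ T\<close> each and their number is of
  order T^(d-1), so the totals near \<open>L\<close> dominate. Induction on the dimension replaces
  the counting.\<close>

lemma sum_gt_geometric_le:
  fixes r :: real
  assumes "0 < r" "r < 1" "d \<ge> 1"
  shows "\<exists>C>0. \<forall>n L. (\<Sum>j\<in>sum_gt d n L. \<Prod>l<d. r ^ j l) \<le> C * (real L + 1) ^ (d - 1) * r ^ L"
proof -
  \<comment> \<open>The weak inequality is chosen because \<open>L \<le> x + s\<close> is equivalent
    to \<open>L - x \<le> s\<close> for every \<open>x\<close>, even with truncated subtraction; the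
    strict version fails for \<open>x > L\<close> and \<open>s = 0\<close>.\<close>
  let ?S = "\<lambda>d n L. \<Sum>j\<in>{..<d} \<rightarrow>\<^sub>E {..n}. if L \<le> (\<Sum>l<d. j l) then \<Prod>l<d. r ^ j l else 0"
  have geo: "(\<Sum>x\<le>n. if L \<le> x then r ^ x else 0) \<le> r ^ L / (1 - r)" for n L
  proof -
    have "(\<Sum>x\<le>n. if L \<le> x then r ^ x else 0) * (1 - r) = (if L \<le> n then r ^ L - r ^ Suc n else 0)"
    proof (induction n)
      case 0
      then show ?case by simp
    next
      case (Suc n)
      have "(\<Sum>x\<le>Suc n. if L \<le> x then r ^ x else 0) * (1 - r)
          = (if L \<le> n then r ^ L - r ^ Suc n else 0) + (if L \<le> Suc n then r ^ Suc n * (1 - r) else 0)"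
        unfolding Suc.IH[symmetric] by (simp add: distrib_right)
      then show ?case by (cases "L \<le> n"; cases "L = Suc n") (simp_all add: algebra_simps)
    qed
    also have "\<dots> \<le> r ^ L" using assms by simp
    finally show ?thesis using assms by (simp add: field_simps)
  qed
  have S: "\<exists>C>0. \<forall>n L. ?S (Suc d) n L \<le> C * (real L + 1) ^ d * r ^ L" for d
  proof (induction d)
    case 0
    have "?S (Suc 0) n L = (\<Sum>x\<le>n. if L \<le> x then r ^ x else 0)" for n L
      unfolding sum_weighted_PiE_Suc[where P = "\<lambda>s. L \<le> s"]
      by (rule sum.cong[OF refl]) (simp add: PiE_empty_domain)
    then have "?S (Suc 0) n L \<le> (1 / (1 - r)) * (real L + 1) ^ 0 * r ^ L" for n L
      using geo[of L n] by simp
    then show ?case using assms by (intro exI[of _ "1 / (1 - r)"]) auto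
  next
    case (Suc d)
    then obtain C where C: "C > 0" "\<And>n L. ?S (Suc d) n L \<le> C * (real L + 1) ^ d * r ^ L" by blast
    have *: "?S (Suc (Suc d)) n L \<le> (C + C / (1 - r)) * (real L + 1) ^ Suc d * r ^ L" for n L
    proof -
      have "?S (Suc (Suc d)) n L = (\<Sum>x\<le>n. r ^ x * ?S (Suc d) n (L - x))"
      proof -
        have "L \<le> x + s \<longleftrightarrow> L - x \<le> s" for x s by linarith
        then show ?thesis by (simp only: sum_weighted_PiE_Suc[where d = "Suc d" and P = "\<lambda>s. L \<le> s"])
      qed
      \<comment> \<open>The product of \<open>r ^ x\<close> and \<open>r ^ (L - x)\<close> is
        \<open>r ^ max x L\<close>. The values \<open>x \<le> L\<close> give the new factor
        \<open>L + 1\<close>, those beyond form a geometric tail.\<close>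
      also have "\<dots> \<le> (\<Sum>x\<le>n. C * (real L + 1) ^ d * ((if x \<le> L then r ^ L else 0) + (if L \<le> x then r ^ x else 0)))"
      proof (rule sum_mono)
        fix x
        have "r ^ x * ?S (Suc d) n (L - x) \<le> r ^ x * (C * (real (L - x) + 1) ^ d * r ^ (L - x))"
          using assms by (intro mult_left_mono C) auto
        also have "\<dots> = C * (real (L - x) + 1) ^ d * r ^ (x + (L - x))"
          by (simp add: power_add)
        also have "\<dots> \<le> C * (real L + 1) ^ d * r ^ (x + (L - x))"
          using assms C by (intro mult_mono power_mono) auto
        also have "\<dots> \<le> C * (real L + 1) ^ d * ((if x \<le> L then r ^ L else 0) + (if L \<le> x then r ^ x else 0))"
          using assms C by (intro mult_left_mono) auto
        finally show "r ^ x * ?S (Suc d) n (L - x)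
          \<le> C * (real L + 1) ^ d * ((if x \<le> L then r ^ L else 0) + (if L \<le> x then r ^ x else 0))" .
      qed
      also have "\<dots> = C * (real L + 1) ^ d * ((\<Sum>x\<le>n. if x \<le> L then r ^ L else 0) + (\<Sum>x\<le>n. if L \<le> x then r ^ x else 0))"
        by (simp only: sum.distrib sum_distrib_left distrib_left)
      also have "\<dots> \<le> C * (real L + 1) ^ d * ((real L + 1) * r ^ L + (real L + 1) * (r ^ L / (1 - r)))"
      proof (intro mult_left_mono add_mono)
        have "(\<Sum>x\<le>n. if x \<le> L then r ^ L else 0) = (\<Sum>x\<in>{..n} \<inter> {..L}. r ^ L)"
          by (subst sum.inter_restrict) (auto intro!: sum.cong)
        also have "\<dots> = real (card ({..n} \<inter> {..L})) * r ^ L" by simp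
        also have "\<dots> \<le> (real L + 1) * r ^ L"
          using card_mono[of "{..L}" "{..n} \<inter> {..L}"] assms by (intro mult_right_mono) auto
        finally show "(\<Sum>x\<le>n. if x \<le> L then r ^ L else 0) \<le> (real L + 1) * r ^ L" .
        have "1 * (r ^ L / (1 - r)) \<le> (real L + 1) * (r ^ L / (1 - r))"
          using assms by (intro mult_right_mono) auto
        then show "(\<Sum>x\<le>n. if L \<le> x then r ^ x else 0) \<le> (real L + 1) * (r ^ L / (1 - r))"
          using geo[of L n] by linarith
      qed (use C in auto)
      also have "\<dots> = (C + C / (1 - r)) * (real L + 1) ^ Suc d * r ^ L"
        by (simp add: algebra_simps add_divide_distrib)
      finally show ?thesis .
    qed
    moreover have "C + C / (1 - r) > 0" using C assms by (simp add: add_pos_pos)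
    ultimately show ?case by blast
  qed
  have "Suc (d - 1) = d" using assms by simp
  from S[of "d - 1", unfolded this] obtain C where C: "C > 0" "\<And>n L. ?S d n L \<le> C * (real L + 1) ^ (d - 1) * r ^ L"
    by blast
  have "(\<Sum>j\<in>sum_gt d n L. \<Prod>l<d. r ^ j l) \<le> C * (real L + 1) ^ (d - 1) * r ^ L" for n L
  proof -
    have "(\<Sum>j\<in>sum_gt d n L. \<Prod>l<d. r ^ j l) = (\<Sum>j\<in>{..<d} \<rightarrow>\<^sub>E {..n}. if L < (\<Sum>l<d. j l) then \<Prod>l<d. r ^ j l else 0)"
      unfolding sum_gt_def by (rule sum.inter_filter) (auto intro!: finite_PiE)
    also have "\<dots> \<le> ?S d n L"
    proof (rule sum_mono)
      fix j :: "nat \<Rightarrow> nat"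
      have "0 \<le> (\<Prod>l<d. r ^ j l)" using assms by (intro prod_nonneg) simp
      then show "(if L < (\<Sum>l<d. j l) then \<Prod>l<d. r ^ j l else 0) \<le> (if L \<le> (\<Sum>l<d. j l) then \<Prod>l<d. r ^ j l else 0)"
        by (cases "L < (\<Sum>l<d. j l)") simp_all
    qed
    also note C(2)
    finally show ?thesis .
  qed
  then show ?thesis using C by blast
qed

section \<open>Active levels and frequencies in one variable\<close>

definition freq_size :: "int \<Rightarrow> real" where
  "freq_size k = max 1 \<bar>of_int k\<bar>"

lemma freq_size_ge_1: "1 \<le> freq_size k"
  by (simp add: freq_size_def)

lemma freq_size_pos [simp]: "0 < freq_size k"
  using freq_size_ge_1[of k] by linarith

text \<open>\<open>level_active j k\<close> bounds the indicator of \<open>level_diff j k \<noteq> 0\<close>.\<close>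

definition level_active :: "nat \<Rightarrow> int \<Rightarrow> real" where
  "level_active j k = (if 2 ^ j \<le> 4 * freq_size k then 1 else 0)"

lemma level_active_nonneg [simp]: "0 \<le> level_active j k"
  by (simp add: level_active_def)

lemma level_active_le_1: "level_active j k \<le> 1"
  by (simp add: level_active_def)

lemma norm_level_diff_le_active: "norm (level_diff j k t) \<le> 2 * level_active j k"
proof (cases "2 ^ j \<le> 4 * freq_size k")
  case True
  then show ?thesis using norm_level_diff by (simp add: level_active_def)
next
  case False
  then have *: "4 * freq_size k < 2 ^ j" by simp
  have "j > 0" using * freq_size_ge_1[of k] by (cases j) auto
  moreover have "4 * \<bar>k\<bar> < 2 ^ j"
  proof -
    have "real_of_int (4 * \<bar>k\<bar>) \<le> 4 * freq_size k" by (simp add: freq_size_def)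
    also note *
    also have "(2::real) ^ j = real_of_int (2 ^ j)" by simp
    finally show ?thesis by linarith
  qed
  ultimately have "level_diff j k t = 0" by (rule level_diff_eq_0)
  then show ?thesis by simp
qed

text \<open>The active levels end where \<open>2 ^ j\<close> reaches \<open>4 * freq_size k\<close>,
  and an increasing geometric sum is comparable to its last term.\<close>

lemma sum_active_powr_le:
  fixes a :: real
  assumes "a > 0"
  shows "\<exists>C>0. \<forall>n k. (\<Sum>j\<le>n. level_active j k * (2 powr a) ^ j) \<le> C * freq_size k powr a"
proof -
  define B where "B = 2 powr a"
  have B: "B > 1" using assms by (simp add: B_def)
  define D where "D = B / (B - 1)"
  have D: "D > 1" using B by (simp add: D_def)
  have geo: "(\<Sum>j\<le>n. B ^ j) \<le> D * B ^ n" for n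
  proof -
    have "(\<Sum>j\<le>n. B ^ j) * (B - 1) \<le> B * B ^ n"
      using B by (induction n) (auto simp: algebra_simps)
    then show ?thesis using B by (simp add: D_def field_simps)
  qed
  have "(\<Sum>j\<le>n. level_active j k * B ^ j) \<le> D * (4 * freq_size k) powr a" for n k
  proof (induction n)
    case 0
    have "1 \<le> (4 * freq_size k) powr a"
      using assms freq_size_ge_1[of k] by (intro ge_one_powr_ge_zero) auto
    then have "1 * 1 \<le> D * (4 * freq_size k) powr a"
      using D by (intro mult_mono) auto
    then show ?case using level_active_le_1[of 0 k] by simp
  next
    case (Suc n)
    show ?case
    proof (cases "2 ^ Suc n \<le> 4 * freq_size k")
      case True
      have "(\<Sum>j\<le>Suc n. level_active j k * B ^ j) \<le> (\<Sum>j\<le>Suc n. B ^ j)"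
        using B level_active_le_1 by (intro sum_mono) (auto simp: mult_left_le_one_le)
      also have "\<dots> \<le> D * B ^ Suc n" by (rule geo)
      also have "B ^ Suc n = (2 ^ Suc n) powr a"
      proof -
        have "B ^ Suc n = (2 powr a) powr real (Suc n)"
          unfolding B_def by (subst powr_realpow) auto
        also have "\<dots> = (2 powr real (Suc n)) powr a" by (simp only: powr_powr mult.commute)
        also have "2 powr real (Suc n) = 2 ^ Suc n" by (subst powr_realpow) auto
        finally show ?thesis .
      qed
      also have "\<dots> \<le> (4 * freq_size k) powr a"
        using True assms by (intro powr_mono2) auto
      finally show ?thesis using D by simp
    next
      case False
      then have "level_active (Suc n) k = 0" by (simp add: level_active_def)
      then show ?thesis using Suc by simp
    qed
  qed
  then have "\<forall>n k. (\<Sum>j\<le>n. level_active j k * (2 powr a) ^ j) \<le> (D * 4 powr a) * freq_size k powr a"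
    by (simp add: B_def powr_mult mult.assoc)
  moreover have "D * 4 powr a > 0" using D by simp
  ultimately show ?thesis by blast
qed

text \<open>The summand is at most a multiple of \<open>i powr (-a) - (i + 1) powr (-a)\<close>, which telescopes.\<close>

lemma powr_tail_sum_le:
  fixes a :: real and N M :: nat
  assumes "a > 0" "N \<ge> 1"
  shows "(\<Sum>i=N..<M. real i powr (-1-a)) \<le> 2 powr (1+a) / a * real N powr (-a)"
proof -
  have step: "real i powr (-1-a) \<le> 2 powr (1+a) / a * (real i powr (-a) - real (Suc i) powr (-a))"
    if i: "i \<ge> 1" for i :: nat
  proof -
    have "\<exists>z. real i < z \<and> z < real (Suc i) \<and>
        real (Suc i) powr (-a) - real i powr (-a) = (real (Suc i) - real i) * ((-a) * z powr (-a - 1))"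
      using i by (intro MVT2) (auto intro!: derivative_eq_intros)
    then obtain z where z: "real i < z" "z < real (Suc i)"
      "real i powr (-a) - real (Suc i) powr (-a) = a * z powr (-a - 1)"
      by (auto simp: algebra_simps)
    have e: "- a - 1 = -1 - a" by simp
    have "real i powr (-1-a) = 2 powr (1 + a) * (2 * real i) powr (-1-a)"
    proof -
      have "2 powr (1 + a) * 2 powr (-1 - a) = (1::real)" by (simp flip: powr_add)
      then show ?thesis using i by (simp add: powr_mult mult.assoc[symmetric])
    qed
    also have "\<dots> \<le> 2 powr (1 + a) * z powr (-1 - a)"
      using z i assms by (intro mult_left_mono powr_mono2') auto
    also have "\<dots> = 2 powr (1+a) / a * (real i powr (-a) - real (Suc i) powr (-a))"
      unfolding z(3)[unfolded e] using assms by simp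
    finally show ?thesis .
  qed
  show ?thesis
  proof (cases "N \<le> M")
    case True
    have "(\<Sum>i=N..<M. real i powr (-1-a)) \<le> (\<Sum>i=N..<M. 2 powr (1+a) / a * (real i powr (-a) - real (Suc i) powr (-a)))"
      using assms by (intro sum_mono step) auto
    also have "\<dots> = 2 powr (1+a) / a * (real N powr (-a) - real M powr (-a))"
      using sum_Suc_diff'[OF True, of "\<lambda>i. - (real i powr (-a))"]
      unfolding sum_distrib_left[symmetric] by simp
    also have "\<dots> \<le> 2 powr (1+a) / a * real N powr (-a)"
      using assms by (intro mult_left_mono) auto
    finally show ?thesis .
  next
    case False
    then show ?thesis using assms by simp
  qed
qed

text \<open>The counterpart for a fixed level: active frequencies have
  \<open>freq_size k \<ge> 2 ^ j / 4\<close>, so this is the tail of a convergent series.\<close>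

lemma sum_freq_active_le:
  fixes a :: real
  assumes "a > 0"
  shows "\<exists>C>0. \<forall>M j. (\<Sum>k=-int M..int M. freq_size k powr (-1-a) * level_active j k)
    \<le> C * (2 powr (-a)) ^ j"
proof -
  define D where "D = 2 powr (1+a) / a"
  have D: "D > 0" using assms by (simp add: D_def)
  have "(\<Sum>k=-int M..int M. freq_size k powr (-1-a) * level_active j k)
      \<le> (4 powr a * (1 + 2 * D)) * (2 powr (-a)) ^ j" for M j
  proof -
    define F where "F k = freq_size k powr (-1-a) * level_active j k" for k
    \<comment> \<open>The size from which on a frequency is active at level
      \<open>j\<close>.\<close>
    define y where "y = (2::real) ^ j / 4"
    have y0: "y > 0" by (simp add: y_def)
    have yp: "y powr (-a) = 4 powr a * (2 powr (-a)) ^ j"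
    proof -
      have "(2 powr (-a)) ^ j = (2 powr (-a)) powr real j" by (subst powr_realpow) auto
      also have "\<dots> = (2 powr real j) powr (-a)" by (simp only: powr_powr mult.commute)
      also have "2 powr real j = 2 ^ j" by (subst powr_realpow) auto
      finally have "(2 powr (-a)) ^ j = (2 ^ j) powr (-a)" .
      moreover have "y powr (-a) = (2 ^ j) powr (-a) / 4 powr (-a)" unfolding y_def by (rule powr_divide)
      moreover have "1 / 4 powr (-a) = (4::real) powr a" by (simp add: powr_minus_divide)
      ultimately show ?thesis by (metis mult.commute mult_1 times_divide_eq_right)
    qed
    \<comment> \<open>Frequency 0 has size 1, so it is active only if \<open>y \<le> 1\<close>, and
      then the right-hand side is at least 1.\<close>
    have F0: "F 0 \<le> y powr (-a)"
    proof (cases "y \<le> 1")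
      case True
      have "1 powr (-a) \<le> y powr (-a)" using True y0 assms by (intro powr_mono2') auto
      then show ?thesis using level_active_le_1[of j 0] by (simp add: F_def freq_size_def)
    next
      case False
      then show ?thesis by (simp add: F_def level_active_def freq_size_def y_def)
    qed
    have Fpos: "(\<Sum>i=1..M. F (int i)) \<le> D * y powr (-a)"
    proof -
      define N where "N = nat (ceiling y)"
      have N: "N \<ge> 1" "y \<le> real N" using y0 unfolding N_def by linarith+
      have "(\<Sum>i=1..M. F (int i)) = (\<Sum>i\<in>{N..<Suc M}. F (int i))"
      proof (rule sum.mono_neutral_right)
        show "\<forall>i\<in>{1..M} - {N..<Suc M}. F (int i) = 0"
        proof
          fix i assume "i \<in> {1..M} - {N..<Suc M}"
          then have "i \<ge> 1" "i < N" by auto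
          then have "real i < y" unfolding N_def by linarith
          then show "F (int i) = 0" using \<open>i \<ge> 1\<close>
            by (simp add: F_def level_active_def freq_size_def y_def max_def)
        qed
      qed (use N in auto)
      also have "\<dots> \<le> (\<Sum>i=N..<Suc M. real i powr (-1-a))"
        using N level_active_le_1 by (intro sum_mono) (auto simp: F_def freq_size_def max_def mult_right_le_one_le)
      also have "\<dots> \<le> D * real N powr (-a)"
        unfolding D_def by (rule powr_tail_sum_le[OF assms N(1)])
      also have "\<dots> \<le> D * y powr (-a)"
        using N y0 D assms by (intro mult_left_mono powr_mono2') auto
      finally show ?thesis .
    qed
    have neg: "F (- k) = F k" for k by (simp add: F_def freq_size_def level_active_def)
    have "{-int M..int M} = {0} \<union> (int ` {1..M} \<union> (\<lambda>i. - int i) ` {1..M})"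
    proof -
      have "k \<in> {0} \<union> (int ` {1..M} \<union> (\<lambda>i. - int i) ` {1..M})" if "k \<in> {-int M..int M}" for k
      proof -
        consider "k = 0" | "k > 0" | "k < 0" by linarith
        then show ?thesis
        proof cases
          case 2
          then have "k \<in> int ` {1..M}" using that by (intro image_eqI[of _ _ "nat k"]) auto
          then show ?thesis by simp
        next
          case 3
          then have "k \<in> (\<lambda>i. - int i) ` {1..M}" using that by (intro image_eqI[of _ _ "nat (-k)"]) auto
          then show ?thesis by simp
        qed auto
      qed
      moreover have "{0} \<union> (int ` {1..M} \<union> (\<lambda>i. - int i) ` {1..M}) \<subseteq> {-int M..int M}" by auto
      ultimately show ?thesis by (intro equalityI subsetI) blast+
    qed
    moreover have "sum F ({0} \<union> (int ` {1..M} \<union> (\<lambda>i. - int i) ` {1..M}))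
        = F 0 + sum F (int ` {1..M} \<union> (\<lambda>i. - int i) ` {1..M})"
      by (subst sum.union_disjoint) auto
    moreover have "sum F (int ` {1..M} \<union> (\<lambda>i. - int i) ` {1..M})
        = sum F (int ` {1..M}) + sum F ((\<lambda>i. - int i) ` {1..M})"
      by (rule sum.union_disjoint) auto
    moreover have "sum F (int ` {1..M}) = (\<Sum>i=1..M. F (int i))"
      by (subst sum.reindex) (auto simp: inj_on_def)
    moreover have "sum F ((\<lambda>i. - int i) ` {1..M}) = (\<Sum>i=1..M. F (- int i))"
      by (subst sum.reindex) (auto simp: inj_on_def)
    ultimately have "(\<Sum>k=-int M..int M. F k) = F 0 + ((\<Sum>i=1..M. F (int i)) + (\<Sum>i=1..M. F (- int i)))"
      by simp
    also have "\<dots> \<le> (1 + 2 * D) * y powr (-a)"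
      using F0 Fpos by (simp add: neg algebra_simps)
    finally show ?thesis unfolding F_def yp by (simp add: mult_ac)
  qed
  moreover have "4 powr a * (1 + 2 * D) > 0" using D by simp
  ultimately show ?thesis by blast
qed

section \<open>The weighted square sum of the errors on exponentials\<close>

lemma finite_subset_cube:
  assumes "finite K" "K \<subseteq> {..<d::nat} \<rightarrow>\<^sub>E (UNIV :: int set)"
  obtains M :: nat where "K \<subseteq> {..<d} \<rightarrow>\<^sub>E {-int M..int M}"
proof -
  have "\<exists>M::nat. \<forall>k\<in>K. \<forall>l<d. \<bar>k l\<bar> \<le> int M"
  proof (intro exI ballI allI impI)
    fix k l assume "k \<in> K" "l < d"
    then have "nat \<bar>k l\<bar> \<le> Max (insert 0 ((\<lambda>(k, l). nat \<bar>k l\<bar>) ` (K \<times> {..<d})))"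
      using assms by (intro Max_ge) auto
    then show "\<bar>k l\<bar> \<le> int (Max (insert 0 ((\<lambda>(k, l). nat \<bar>k l\<bar>) ` (K \<times> {..<d}))))"
      by linarith
  qed
  then obtain M :: nat where M: "\<And>k l. k \<in> K \<Longrightarrow> l < d \<Longrightarrow> \<bar>k l\<bar> \<le> int M" by blast
  have "K \<subseteq> {..<d} \<rightarrow>\<^sub>E {-int M..int M}"
  proof
    fix k assume k: "k \<in> K"
    then have "k \<in> extensional {..<d}" using assms by (auto simp: PiE_iff)
    moreover have "k l \<in> {-int M..int M}" if "l < d" for l using M[OF k that] by auto
    ultimately show "k \<in> {..<d} \<rightarrow>\<^sub>E {-int M..int M}" by (auto simp: PiE_iff)
  qed
  then show ?thesis by (rule that)
qed

lemma sum_gt_subset: "sum_gt d n L \<subseteq> {..<d} \<rightarrow>\<^sub>E {..n}"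
  unfolding sum_gt_def by blast

text \<open>Cauchy-Schwarz over the levels yields one factor \<open>2 powr (-a)\<close> per unit of
  level, the sum over the frequencies for a fixed level vector yields a second one. Only then are
  the levels summed, with ratio \<open>2 powr (- 2 * a)\<close>.\<close>

lemma smolyak_error_square_sum_le:
  fixes a :: real
  assumes "a > 0" "d \<ge> 1"
  shows "\<exists>C>0. \<forall>L t K. finite K \<longrightarrow> K \<subseteq> {..<d} \<rightarrow>\<^sub>E UNIV \<longrightarrow>
    (\<Sum>k\<in>K. (\<Prod>l<d. freq_size (k l) powr (-1 - 2 * a)) *
       (norm (torus_char d k t - smolyak d L (torus_char d k) t))\<^sup>2)
     \<le> C * (real L + 1) ^ (d - 1) * (2 powr (- 2 * a)) ^ L"
proof -
  obtain C1 where C1: "C1 > 0" "\<And>n k. (\<Sum>j\<le>n. level_active j k * (2 powr a) ^ j) \<le> C1 * freq_size k powr a"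
    using sum_active_powr_le[OF assms(1)] by blast
  obtain C2 where C2: "C2 > 0" "\<And>M j. (\<Sum>k=-int M..int M. freq_size k powr (-1-a) * level_active j k) \<le> C2 * (2 powr (-a)) ^ j"
    using sum_freq_active_le[OF assms(1)] by blast
  have "2 powr (- 2 * a) < (1::real)" using assms by (subst powr_less_one) auto
  then obtain C3 where C3: "C3 > 0"
      "\<And>n L. (\<Sum>j\<in>sum_gt d n L. \<Prod>l<d. (2 powr (- 2 * a)) ^ j l) \<le> C3 * (real L + 1) ^ (d - 1) * (2 powr (- 2 * a)) ^ L"
    using sum_gt_geometric_le[of "2 powr (- 2 * a)" d] assms(2) by auto
  define r where "r = 2 powr (-a)"
  have r: "r > 0" by (simp add: r_def)
  have "(\<Sum>k\<in>K. (\<Prod>l<d. freq_size (k l) powr (-1 - 2 * a)) *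
       (norm (torus_char d k t - smolyak d L (torus_char d k) t))\<^sup>2)
     \<le> (4 ^ d * C1 ^ d * C2 ^ d * C3) * (real L + 1) ^ (d - 1) * (2 powr (- 2 * a)) ^ L"
    if K: "finite K" "K \<subseteq> {..<d} \<rightarrow>\<^sub>E UNIV" for L t K
  proof -
    obtain M where M: "K \<subseteq> {..<d} \<rightarrow>\<^sub>E {-int M..int M}" using finite_subset_cube[OF K] .
    \<comment> \<open>This gives \<open>L \<le> n\<close> and \<open>2 * M < n < 2 ^ n\<close>, so
      the cap resolves every frequency in \<open>K\<close>.\<close>
    define n where "n = L + 2 * M + 1"
    let ?A = "\<lambda>j k. \<Prod>l<d. level_active (j l) (k l)"
    have pointwise: "(norm (torus_char d k t - smolyak d L (torus_char d k) t))\<^sup>2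
        \<le> 4 ^ d * (C1 ^ d * (\<Prod>l<d. freq_size (k l) powr a)) * (\<Sum>j\<in>sum_gt d n L. ?A j k * (\<Prod>l<d. r ^ j l))"
      if k: "k \<in> K" for k
    proof -
      have "2 * \<bar>k l\<bar> < 2 ^ n" if "l < d" for l
      proof -
        have "\<bar>k l\<bar> \<le> int M" using PiE_mem[OF subsetD[OF M k], of l] that by auto
        then have "2 * \<bar>k l\<bar> \<le> int (2 * M)" by simp
        also have "int (2 * M) < int (2 ^ n)"
          unfolding of_nat_less_iff using less_exp[of n] by (simp add: n_def)
        finally show ?thesis by simp
      qed
      then have "torus_char d k t - smolyak d L (torus_char d k) t
          = (\<Sum>j\<in>sum_gt d n L. \<Prod>l<d. level_diff (j l) (k l) (t l))"
        by (intro smolyak_error_char) (auto simp: n_def)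
      also have "norm \<dots> \<le> (\<Sum>j\<in>sum_gt d n L. 2 ^ d * ?A j k)"
      proof (rule sum_norm_le)
        fix j
        have "norm (\<Prod>l<d. level_diff (j l) (k l) (t l)) \<le> (\<Prod>l<d. 2 * level_active (j l) (k l))"
          unfolding prod_norm[symmetric] by (intro prod_mono) (auto intro: norm_level_diff_le_active)
        then show "norm (\<Prod>l<d. level_diff (j l) (k l) (t l)) \<le> 2 ^ d * ?A j k"
          by (simp add: prod.distrib)
      qed
      finally have *: "norm (torus_char d k t - smolyak d L (torus_char d k) t) \<le> 2 ^ d * (\<Sum>j\<in>sum_gt d n L. ?A j k)"
        by (simp add: sum_distrib_left)
      \<comment> \<open>A product of 0/1 indicators is idempotent, so a copy can be put into each
        Cauchy-Schwarz factor and survives the squaring.\<close>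
      have sq: "(?A j k)\<^sup>2 = ?A j k" for j
        unfolding prod_power_distrib by (intro prod.cong) (auto simp: level_active_def)
      \<comment> \<open>The weights \<open>B ^ j\<close> and \<open>(1 / B) ^ j\<close> square to
        the powers of \<open>2 powr a\<close> and \<open>r\<close>. Without weights, Cauchy-Schwarz
        would bring in the number of active levels, a product of logarithms of the
        frequencies.\<close>
      define B where "B = 2 powr (a / 2)"
      have B2: "B ^ 2 = 2 powr a" by (simp add: B_def power2_eq_square flip: powr_add)
      then have "(1 / B) ^ 2 = r" by (simp add: power_one_over r_def powr_minus_divide)
      then have B: "B > 0" "B ^ 2 = 2 powr a" "(1 / B) ^ 2 = r" using B2 by (simp_all add: B_def)
      have "(\<Sum>j\<in>sum_gt d n L. ?A j k)\<^sup>2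
          = (\<Sum>j\<in>sum_gt d n L. (?A j k * (\<Prod>l<d. B ^ j l)) * (?A j k * (\<Prod>l<d. (1 / B) ^ j l)))\<^sup>2"
      proof (intro arg_cong[of _ _ "\<lambda>x. x\<^sup>2"] sum.cong refl)
        fix j
        have xy: "(\<Prod>l<d. B ^ j l) * (\<Prod>l<d. (1 / B) ^ j l) = 1"
          unfolding prod.distrib[symmetric] power_mult_distrib[symmetric] using B(1) by simp
        then have "(?A j k * (\<Prod>l<d. B ^ j l)) * (?A j k * (\<Prod>l<d. (1 / B) ^ j l)) = (?A j k)\<^sup>2"
        proof -
          have "(x * y) * (x * z) = x * x * (y * z)" for x y z :: real by (simp only: mult_ac)
          from this[of "?A j k" "\<Prod>l<d. B ^ j l" "\<Prod>l<d. (1 / B) ^ j l"] xy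
          show ?thesis by (simp only: mult_1_right power2_eq_square)
        qed
        then show "?A j k = (?A j k * (\<Prod>l<d. B ^ j l)) * (?A j k * (\<Prod>l<d. (1 / B) ^ j l))"
          by (simp only: sq)
      qed
      also have "\<dots> \<le> (\<Sum>j\<in>sum_gt d n L. (?A j k * (\<Prod>l<d. B ^ j l))\<^sup>2) * (\<Sum>j\<in>sum_gt d n L. (?A j k * (\<Prod>l<d. (1 / B) ^ j l))\<^sup>2)"
        by (rule Cauchy_Schwarz_ineq_sum)
      also have "\<dots> = (\<Sum>j\<in>sum_gt d n L. ?A j k * (\<Prod>l<d. (2 powr a) ^ j l)) * (\<Sum>j\<in>sum_gt d n L. ?A j k * (\<Prod>l<d. r ^ j l))"
      proof -
        have "(?A j k * (\<Prod>l<d. z ^ j l))\<^sup>2 = ?A j k * (\<Prod>l<d. (z ^ 2) ^ j l)" for j and z :: real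
        proof -
          have "(z ^ i)\<^sup>2 = (z\<^sup>2) ^ i" for i by (metis power_commutes power_mult mult.commute)
          then show ?thesis unfolding power_mult_distrib sq by (simp only: prod_power_distrib)
        qed
        then show ?thesis by (simp only: B)
      qed
      also have "\<dots> \<le> (C1 ^ d * (\<Prod>l<d. freq_size (k l) powr a)) * (\<Sum>j\<in>sum_gt d n L. ?A j k * (\<Prod>l<d. r ^ j l))"
      proof (rule mult_right_mono)
        \<comment> \<open>Dropping the constraint on the total makes the sum factor over the
          coordinates; the decay in \<open>L\<close> comes from the other factor alone.\<close>
        have "(\<Sum>j\<in>sum_gt d n L. ?A j k * (\<Prod>l<d. (2 powr a) ^ j l))
            \<le> (\<Sum>j\<in>{..<d} \<rightarrow>\<^sub>E {..n}. ?A j k * (\<Prod>l<d. (2 powr a) ^ j l))"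
          by (rule sum_mono2) (simp_all add: finite_PiE sum_gt_subset prod_nonneg)
        also have "\<dots> = (\<Prod>l<d. \<Sum>j\<le>n. level_active j (k l) * (2 powr a) ^ j)"
          by (subst prod_sum_PiE) (auto simp: prod.distrib)
        also have "\<dots> \<le> (\<Prod>l<d. C1 * freq_size (k l) powr a)"
          by (intro prod_mono) (auto intro!: C1 sum_nonneg)
        finally show "(\<Sum>j\<in>sum_gt d n L. ?A j k * (\<Prod>l<d. (2 powr a) ^ j l)) \<le> C1 ^ d * (\<Prod>l<d. freq_size (k l) powr a)"
          by (simp add: prod.distrib)
        show "0 \<le> (\<Sum>j\<in>sum_gt d n L. ?A j k * (\<Prod>l<d. r ^ j l))"
          using r by (auto intro!: sum_nonneg mult_nonneg_nonneg prod_nonneg)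
      qed
      finally have **: "(\<Sum>j\<in>sum_gt d n L. ?A j k)\<^sup>2
          \<le> (C1 ^ d * (\<Prod>l<d. freq_size (k l) powr a)) * (\<Sum>j\<in>sum_gt d n L. ?A j k * (\<Prod>l<d. r ^ j l))" .
      have "(norm (torus_char d k t - smolyak d L (torus_char d k) t))\<^sup>2 \<le> (2 ^ d * (\<Sum>j\<in>sum_gt d n L. ?A j k))\<^sup>2"
        using * by (intro power_mono) auto
      also have "\<dots> = 4 ^ d * (\<Sum>j\<in>sum_gt d n L. ?A j k)\<^sup>2"
      proof -
        have "((2::real) ^ d)\<^sup>2 = 4 ^ d" by (simp add: power2_eq_square flip: power_mult_distrib)
        then show ?thesis by (simp only: power_mult_distrib)
      qed
      also have "\<dots> \<le> 4 ^ d * ((C1 ^ d * (\<Prod>l<d. freq_size (k l) powr a)) * (\<Sum>j\<in>sum_gt d n L. ?A j k * (\<Prod>l<d. r ^ j l)))"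
        by (rule mult_left_mono[OF **]) simp
      finally show ?thesis by (simp only: mult.assoc)
    qed
    have "(\<Sum>k\<in>K. (\<Prod>l<d. freq_size (k l) powr (-1 - 2 * a)) *
       (norm (torus_char d k t - smolyak d L (torus_char d k) t))\<^sup>2)
      \<le> (\<Sum>k\<in>K. (4 ^ d * C1 ^ d) * (\<Sum>j\<in>sum_gt d n L. (\<Prod>l<d. r ^ j l) * (\<Prod>l<d. freq_size (k l) powr (-1 - a) * level_active (j l) (k l))))"
    proof (rule sum_mono)
      fix k assume k: "k \<in> K"
      \<comment> \<open>Of the exponent \<open>-1 - 2 * a\<close> a part is spent on the first
        Cauchy-Schwarz factor; the remaining \<open>-1 - a\<close> is still summable.\<close>
      have q: "(\<Prod>l<d. freq_size (k l) powr (-1 - 2 * a)) * (\<Prod>l<d. freq_size (k l) powr a) = (\<Prod>l<d. freq_size (k l) powr (-1 - a))"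
      proof -
        have "-1 - 2 * a + a = -1 - a" by simp
        then show ?thesis by (simp only: prod.distrib[symmetric] powr_add[symmetric])
      qed
      have "(\<Prod>l<d. freq_size (k l) powr (-1 - 2 * a)) * (norm (torus_char d k t - smolyak d L (torus_char d k) t))\<^sup>2
         \<le> (\<Prod>l<d. freq_size (k l) powr (-1 - 2 * a)) * (4 ^ d * (C1 ^ d * (\<Prod>l<d. freq_size (k l) powr a)) * (\<Sum>j\<in>sum_gt d n L. ?A j k * (\<Prod>l<d. r ^ j l)))"
        using pointwise[OF k] by (intro mult_left_mono prod_nonneg) auto
      also have "\<dots> = (4 ^ d * C1 ^ d) * (((\<Prod>l<d. freq_size (k l) powr (-1 - 2 * a)) * (\<Prod>l<d. freq_size (k l) powr a)) * (\<Sum>j\<in>sum_gt d n L. ?A j k * (\<Prod>l<d. r ^ j l)))"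
        by (simp only: mult_ac)
      also have "\<dots> = (4 ^ d * C1 ^ d) * (\<Sum>j\<in>sum_gt d n L. (\<Prod>l<d. r ^ j l) * (\<Prod>l<d. freq_size (k l) powr (-1 - a) * level_active (j l) (k l)))"
        unfolding q sum_distrib_left prod.distrib by (intro sum.cong refl) (simp only: mult_ac)
      finally show "(\<Prod>l<d. freq_size (k l) powr (-1 - 2 * a)) * (norm (torus_char d k t - smolyak d L (torus_char d k) t))\<^sup>2
        \<le> (4 ^ d * C1 ^ d) * (\<Sum>j\<in>sum_gt d n L. (\<Prod>l<d. r ^ j l) * (\<Prod>l<d. freq_size (k l) powr (-1 - a) * level_active (j l) (k l)))" .
    qed
    also have "\<dots> = (4 ^ d * C1 ^ d) * (\<Sum>j\<in>sum_gt d n L. (\<Prod>l<d. r ^ j l) * (\<Sum>k\<in>K. \<Prod>l<d. freq_size (k l) powr (-1 - a) * level_active (j l) (k l)))"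
      unfolding sum_distrib_left[symmetric] by (subst sum.swap) (simp only: sum_distrib_left)
    also have "\<dots> \<le> (4 ^ d * C1 ^ d) * (\<Sum>j\<in>sum_gt d n L. (\<Prod>l<d. r ^ j l) * (C2 ^ d * (\<Prod>l<d. r ^ j l)))"
    proof (intro mult_left_mono sum_mono)
      fix j
      \<comment> \<open>Enlarging \<open>K\<close> to a cube turns the sum over the frequencies into
        a product of univariate sums.\<close>
      have "(\<Sum>k\<in>K. \<Prod>l<d. freq_size (k l) powr (-1 - a) * level_active (j l) (k l))
        \<le> (\<Sum>k\<in>{..<d} \<rightarrow>\<^sub>E {-int M..int M}. \<Prod>l<d. freq_size (k l) powr (-1 - a) * level_active (j l) (k l))"
        using M by (intro sum_mono2) (simp_all add: finite_PiE prod_nonneg)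
      also have "\<dots> = (\<Prod>l<d. \<Sum>k=-int M..int M. freq_size k powr (-1 - a) * level_active (j l) k)"
        by (rule prod_sum_PiE[symmetric]) auto
      also have "\<dots> \<le> (\<Prod>l<d. C2 * r ^ j l)"
        unfolding r_def by (intro prod_mono) (auto intro!: C2 sum_nonneg)
      finally show "(\<Sum>k\<in>K. \<Prod>l<d. freq_size (k l) powr (-1 - a) * level_active (j l) (k l)) \<le> C2 ^ d * (\<Prod>l<d. r ^ j l)"
        by (simp add: prod.distrib)
    qed (use r C1 in \<open>auto intro!: prod_nonneg mult_nonneg_nonneg\<close>)
    also have "\<dots> = (4 ^ d * C1 ^ d * C2 ^ d) * (\<Sum>j\<in>sum_gt d n L. \<Prod>l<d. (2 powr (- 2 * a)) ^ j l)"
    proof -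
      have "r * r = 2 powr (- 2 * a)" by (simp add: r_def flip: powr_add)
      then have "(\<Prod>l<d. r ^ j l) * (C2 ^ d * (\<Prod>l<d. r ^ j l)) = C2 ^ d * (\<Prod>l<d. (2 powr (- 2 * a)) ^ j l)" for j
        unfolding \<open>r * r = _\<close>[symmetric] power_mult_distrib prod.distrib by (simp only: mult_ac)
      then show ?thesis by (simp only: sum_distrib_left[symmetric] mult.assoc)
    qed
    also have "\<dots> \<le> (4 ^ d * C1 ^ d * C2 ^ d) * (C3 * (real L + 1) ^ (d - 1) * (2 powr (- 2 * a)) ^ L)"
      using C1 C2 by (intro mult_left_mono C3) auto
    finally show ?thesis by (simp only: mult.assoc)
  qed
  moreover have "4 ^ d * C1 ^ d * C2 ^ d * C3 > 0" using C1 C2 C3 by simp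
  ultimately show ?thesis by blast
qed

section \<open>The torus as a finite measure space, and its characters\<close>

abbreviation circle :: "real measure" where
  "circle \<equiv> restrict_space lborel {0..2*pi}"

lemma space_circle: "space circle = {0..2*pi}"
  by (simp add: space_restrict_space)

lemma emeasure_circle: "emeasure circle (space circle) = ennreal (2 * pi)"
  by (subst emeasure_restrict_space) (auto simp: space_restrict_space)

interpretation circle: finite_measure circle
  by (rule finite_measureI) (simp only: emeasure_circle ennreal_neq_top not_False_eq_True infinity_ennreal_def)

interpretation circles: product_sigma_finite "\<lambda>i::nat. circle"
  by standard

lemma space_torus: "space (torus d) = {..<d} \<rightarrow>\<^sub>E {0..2*pi}"
  by (simp add: torus_def space_PiM space_circle)

lemma emeasure_torus: "emeasure (torus d) (space (torus d)) = ennreal ((2 * pi) ^ d)"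
proof -
  have "emeasure (torus d) (space (torus d)) = (\<Prod>i<d. emeasure circle (space circle))"
    unfolding torus_def space_PiM by (rule circles.emeasure_PiM) (simp_all only: sets.top finite_lessThan)
  also have "\<dots> = ennreal ((2 * pi) ^ d)"
    unfolding emeasure_circle by (simp add: ennreal_power)
  finally show ?thesis .
qed

interpretation torus: finite_measure "torus d" for d
  by (rule finite_measureI) (simp add: emeasure_torus)

lemma measure_torus: "measure (torus d) (space (torus d)) = (2 * pi) ^ d"
  by (simp add: measure_def emeasure_torus)

lemma measurable_torus_coord [measurable]:
  assumes "l < d"
  shows "(\<lambda>x. x l) \<in> borel_measurable (torus d)"
proof -
  have "(\<lambda>x. x l) \<in> torus d \<rightarrow>\<^sub>M circle"
    using measurable_component_singleton[of l "{..<d}" "\<lambda>_. circle"] assms unfolding torus_def by simp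
  from measurable_compose[OF this, of "\<lambda>x. x" borel] show ?thesis
    by (simp add: measurable_restrict_space1)
qed

lemma continuous_on_coord: "continuous_on S (\<lambda>x::nat \<Rightarrow> real. x l)"
  by (rule continuous_on_subset[OF continuous_on_product_coordinates subset_UNIV])

text \<open>Points are functions on all natural numbers, equal to \<open>undefined\<close> outside
  \<open>{..<d}\<close>. The cube is therefore a full product with singleton factors there, and
  Tychonoff's theorem applies.\<close>

lemma compact_torus: "compact (space (torus d))"
proof -
  have "space (torus d) = PiE UNIV (\<lambda>i. if i < d then {0..2*pi} else {undefined})"
    unfolding space_torus PiE_def Pi_def extensional_def by (intro set_eqI) (simp, meson)
  also have "compact \<dots>"
  proof -
    have "compactin (product_topology (\<lambda>i. euclidean) UNIV)
        (PiE UNIV (\<lambda>i::nat. if i < d then {0..2*pi} else {undefined :: real}))"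
      unfolding compactin_PiE by simp
    then show ?thesis by (simp add: euclidean_product_topology)
  qed
  finally show ?thesis .
qed

lemma continuous_on_torus_char: "continuous_on S (torus_char d k)"
  unfolding torus_char_def by (intro continuous_intros continuous_on_coord)

lemma measurable_torus_char [measurable]: "torus_char d k \<in> borel_measurable (torus d)"
proof -
  have 1: "(\<lambda>t. \<Sum>l<d. of_int (k l) * t l) \<in> borel_measurable (torus d)"
    by (intro borel_measurable_sum borel_measurable_times borel_measurable_const measurable_torus_coord) simp
  have 2: "cis \<in> borel \<rightarrow>\<^sub>M borel"
    by (intro borel_measurable_continuous_onI continuous_intros)
  from measurable_compose[OF 1 2] show ?thesis by (simp add: torus_char_def[abs_def])
qed

lemma torus_char_torus_eq:
  assumes "torus_eq d x y"
  shows "torus_char d k x = torus_char d k y"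
  unfolding torus_char_prod
proof (rule prod.cong[OF refl])
  fix l assume "l \<in> {..<d}"
  then have "x l = y l \<or> {x l, y l} = {0, 2*pi}" using assms by (simp add: torus_eq_def)
  moreover have "cis (of_int (k l) * (2 * pi)) = 1"
    using cis_multiple_2pi[of "of_int (k l)"] by (simp add: mult_ac del: cis_multiple_2pi)
  ultimately show "cis (of_int (k l) * x l) = cis (of_int (k l) * y l)"
    by (auto simp: doubleton_eq_iff)
qed

lemma torus_char_mult: "torus_char d k t * torus_char d l t = torus_char d (\<lambda>i. k i + l i) t"
  by (simp add: torus_char_def cis_mult sum.distrib algebra_simps)

lemma integral_circle_cis:
  "integral\<^sup>L circle (\<lambda>x. cis (of_int k * x)) = (if k = 0 then 2 * pi else 0)"
proof (cases "k = 0")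
  case True
  then show ?thesis using emeasure_circle by (simp add: measure_def scaleR_conv_of_real)
next
  case False
  have "integral\<^sup>L circle (\<lambda>x. cis (of_int k * x)) = (LINT x|lborel. indicator {0..2*pi} x *\<^sub>R cis (of_int k * x))"
    by (subst integral_restrict_space) auto
  also have "\<dots> = cis (of_int k * (2 * pi)) / (\<i> * of_int k) - cis (of_int k * 0) / (\<i> * of_int k)"
  proof (rule integral_FTC_Icc)
    fix x assume "0 \<le> x" "x \<le> 2 * pi"
    show "((\<lambda>x. cis (of_int k * x) / (\<i> * of_int k)) has_vector_derivative cis (of_int k * x)) (at x within {0..2*pi})"
      unfolding cis_conv_exp using False
      by (auto intro!: derivative_eq_intros has_vector_derivative_real_field simp: field_simps)
  qed (auto intro!: continuous_intros)
  also have "cis (of_int k * (2 * pi)) = 1"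
    using cis_multiple_2pi[of "of_int k"] by (simp add: mult_ac del: cis_multiple_2pi)
  finally show ?thesis using False by simp
qed

lemma integrable_circle_cis: "integrable circle (\<lambda>x. cis (of_int k * x))"
proof (rule circle.integrable_const_bound[of _ 1])
  have "(\<lambda>x. cis (of_int k * x)) \<in> borel_measurable borel"
    by (intro borel_measurable_continuous_onI continuous_intros)
  then show "(\<lambda>x. cis (of_int k * x)) \<in> borel_measurable circle"
    by (intro measurable_restrict_space1) simp
qed simp

lemma integral_torus_char:
  "integral\<^sup>L (torus d) (torus_char d k) = (if \<forall>l<d. k l = 0 then (2 * pi) ^ d else 0)"
proof -
  have "integral\<^sup>L (torus d) (torus_char d k) = (\<Prod>l<d. integral\<^sup>L circle (\<lambda>x. cis (of_int (k l) * x)))"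
    unfolding torus_char_prod[abs_def] torus_def
    by (rule circles.product_integral_prod) (auto intro: integrable_circle_cis)
  also have "\<dots> = (if \<forall>l<d. k l = 0 then (2 * pi) ^ d else 0)"
    unfolding integral_circle_cis by (auto intro!: prod_zero)
  finally show ?thesis .
qed

lemma integrable_mult_torus_char:
  assumes "integrable (torus d) h"
  shows "integrable (torus d) (\<lambda>x. h x * torus_char d k x)"
proof (rule Bochner_Integration.integrable_bound[OF assms])
  show "(\<lambda>x. h x * torus_char d k x) \<in> borel_measurable (torus d)"
    using assms by (intro borel_measurable_times measurable_torus_char) auto
qed (simp add: norm_mult)

lemma fourier_coeff_torus_char:
  "fourier_coeff d f k = (LINT x|torus d. f x * torus_char d (\<lambda>i. - k i) x) / (2 * pi) ^ d"
  unfolding fourier_coeff_def torus_char_def cis_conv_exp by (simp add: sum_negf)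

section \<open>Uniqueness of Fourier coefficients for continuous functions\<close>

text \<open>Uniqueness of Fourier coefficients. The non-negative trigonometric polynomials
  \<open>\<Prod>i. ((1 + cos (t i - x i)) / 2) ^ n\<close> concentrate at \<open>x\<close> as \<open>n\<close> grows, so a continuous function
  orthogonal to all of them vanishes at \<open>x\<close>.\<close>

definition all_coeffs_zero :: "nat \<Rightarrow> ((nat \<Rightarrow> real) \<Rightarrow> complex) \<Rightarrow> bool" where
  "all_coeffs_zero d h \<longleftrightarrow> integrable (torus d) h \<and> (\<forall>k. (LINT t|torus d. h t * torus_char d k t) = 0)"

definition bump :: "real \<Rightarrow> real \<Rightarrow> real" where
  "bump a t = (1 + cos (t - a)) / 2"

lemma bump_bounds: "0 \<le> bump a t" "bump a t \<le> 1"
proof -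
  obtain c where "cos (t - a) = c" "-1 \<le> c" "c \<le> 1" by simp
  then show "0 \<le> bump a t" "bump a t \<le> 1" by (simp_all add: bump_def)
qed

lemma bump_eq_cis: "complex_of_real (bump a t) = 1/2 + (cis (- a) / 4) * cis t + (cis a / 4) * cis (- t)"
  by (simp add: bump_def complex_eq_iff cos_diff algebra_simps add_divide_distrib diff_divide_distrib)

lemma torus_char_shift:
  assumes "i < d"
  shows "torus_char d (k(i := k i + m)) t = torus_char d k t * cis (of_int m * t i)"
proof -
  have "(\<Sum>l<d. of_int ((k(i := k i + m)) l) * t l) = (\<Sum>l<d. of_int (k l) * t l + (if l = i then of_int m * t i else 0))"
    by (intro sum.cong) (auto simp: algebra_simps)
  also have "\<dots> = (\<Sum>l<d. of_int (k l) * t l) + of_int m * t i"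
    using assms by (simp add: sum.distrib)
  finally show ?thesis by (simp add: torus_char_def cis_mult)
qed

text \<open>\<open>bump\<close> only has the frequencies -1, 0 and 1, so each integral of the
  product against a character is a combination of three integrals that vanish for
  \<open>h\<close>.\<close>

lemma all_coeffs_zero_mult_bump:
  assumes h: "all_coeffs_zero d h" and i: "i < d"
  shows "all_coeffs_zero d (\<lambda>t. h t * complex_of_real (bump a (t i)))"
proof -
  have int: "integrable (torus d) (\<lambda>t. h t * torus_char d k t)" for k
    using h by (intro integrable_mult_torus_char) (simp add: all_coeffs_zero_def)
  have eq: "h t * complex_of_real (bump a (t i)) * torus_char d k t =
      (1/2) * (h t * torus_char d k t) + (cis (- a) / 4) * (h t * torus_char d (k(i := k i + 1)) t)
      + (cis a / 4) * (h t * torus_char d (k(i := k i + (-1))) t)" for t k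
    unfolding bump_eq_cis torus_char_shift[OF i] by (simp add: algebra_simps)
  have "integrable (torus d) (\<lambda>t. h t * complex_of_real (bump a (t i)))"
  proof (rule Bochner_Integration.integrable_bound)
    show "integrable (torus d) h" using h by (simp add: all_coeffs_zero_def)
    have "(\<lambda>t. complex_of_real (bump a (t i))) \<in> borel_measurable (torus d)"
    proof -
      have "(\<lambda>y. complex_of_real (bump a y)) \<in> borel_measurable borel"
        unfolding bump_def by (intro borel_measurable_continuous_onI continuous_intros) simp
      from measurable_compose[OF measurable_torus_coord[OF i] this] show ?thesis .
    qed
    moreover have "h \<in> borel_measurable (torus d)"
      using h borel_measurable_integrable unfolding all_coeffs_zero_def by blast
    ultimately show "(\<lambda>t. h t * complex_of_real (bump a (t i))) \<in> borel_measurable (torus d)"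
      by (intro borel_measurable_times)
    show "AE t in torus d. norm (h t * complex_of_real (bump a (t i))) \<le> norm (h t)"
      using bump_bounds by (intro AE_I2) (simp add: norm_mult mult_left_le)
  qed
  moreover have "(LINT t|torus d. h t * complex_of_real (bump a (t i)) * torus_char d k t) = 0" for k
  proof -
    have "(LINT t|torus d. h t * torus_char d k t) = 0" for k
      using h by (simp add: all_coeffs_zero_def)
    then show ?thesis
      unfolding eq by (simp only: Bochner_Integration.integral_add Bochner_Integration.integrable_add
          integrable_mult_right int integral_mult_right_zero mult_zero_right add_0_right)
  qed
  ultimately show ?thesis by (simp add: all_coeffs_zero_def)
qed

definition torus_bump :: "nat \<Rightarrow> (nat \<Rightarrow> real) \<Rightarrow> (nat \<Rightarrow> real) \<Rightarrow> real" where
  "torus_bump d x t = (\<Prod>i<d. bump (x i) (t i))"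

lemma torus_bump_nonneg: "0 \<le> torus_bump d x t"
  unfolding torus_bump_def by (intro prod_nonneg) (simp add: bump_bounds)

lemma torus_bump_le_1: "torus_bump d x t \<le> 1"
  unfolding torus_bump_def by (intro prod_le_1) (simp add: bump_bounds)

lemma continuous_on_torus_bump: "continuous_on S (torus_bump d x)"
  unfolding torus_bump_def[abs_def] bump_def by (intro continuous_intros continuous_on_coord) simp

lemma all_coeffs_zero_mult_torus_bump:
  assumes "all_coeffs_zero d h"
  shows "all_coeffs_zero d (\<lambda>t. h t * complex_of_real (torus_bump d x t ^ n))"
proof (induction n)
  case 0
  then show ?case using assms by simp
next
  case (Suc n)
  have "m \<le> d \<Longrightarrow> all_coeffs_zero d (\<lambda>t. h t * complex_of_real (torus_bump d x t ^ n * (\<Prod>i<m. bump (x i) (t i))))" for m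
  proof (induction m)
    case 0
    then show ?case using Suc by simp
  next
    case (Suc m)
    then have "all_coeffs_zero d (\<lambda>t. h t * complex_of_real (torus_bump d x t ^ n * (\<Prod>i<m. bump (x i) (t i))) * complex_of_real (bump (x m) (t m)))"
      by (intro all_coeffs_zero_mult_bump) auto
    then show ?case by (simp add: mult.assoc)
  qed
  from this[of d] show ?case by (simp add: torus_bump_def mult.commute)
qed

text \<open>A product of numbers in [0,1] is 1 only if all factors are. Each difference of
  coordinates is then a multiple of 2 pi between -2 pi and 2 pi, and the extreme multiples are the
  identified faces.\<close>

lemma torus_bump_eq_1:
  assumes x: "x \<in> space (torus d)" and t: "t \<in> space (torus d)" and 1: "torus_bump d x t = 1"
  shows "torus_eq d t x"
  unfolding torus_eq_def
proof (intro allI impI)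
  fix i assume i: "i < d"
  have "torus_bump d x t = bump (x i) (t i) * (\<Prod>l\<in>{..<d} - {i}. bump (x l) (t l))"
    unfolding torus_bump_def using i by (intro prod.remove) auto
  also have "\<dots> \<le> bump (x i) (t i) * 1"
    by (intro mult_left_mono prod_le_1) (simp_all add: bump_bounds)
  finally have "bump (x i) (t i) = 1" using 1 bump_bounds(2)[of "x i" "t i"] by simp
  then have "cos (t i - x i) = 1" by (simp add: bump_def)
  then obtain n :: int where n: "t i - x i = of_int n * 2 * pi" using cos_one_2pi_int by blast
  have bd: "0 \<le> x i" "x i \<le> 2*pi" "0 \<le> t i" "t i \<le> 2*pi"
    using PiE_mem[OF x[unfolded space_torus], of i] PiE_mem[OF t[unfolded space_torus], of i] i by simp_all
  have "of_int n * (2 * pi) \<le> 1 * (2 * pi)" "(-1) * (2 * pi) \<le> of_int n * (2 * pi)" using n bd by linarith+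
  then have "of_int n \<le> (1::real)" "(-1::real) \<le> of_int n"
    using mult_le_cancel_right_pos[of "2 * pi"] pi_gt_zero by (metis mult_pos_pos zero_less_numeral)+
  then consider "n = -1" | "n = 0" | "n = 1" by linarith
  then show "t i = x i \<or> {t i, x i} = {0, 2 * pi}"
  proof cases
    case 1
    then have "t i = 0" "x i = 2 * pi" using n bd by simp_all
    then show ?thesis by simp
  next
    case 2
    then show ?thesis using n by simp
  next
    case 3
    then have "t i = 2 * pi" "x i = 0" using n bd by simp_all
    then show ?thesis by (simp add: insert_commute)
  qed
qed

lemma emeasure_circle_nbhd_pos:
  assumes "a \<in> {0..2*pi}" "e > 0"
  shows "emeasure circle ({0..2*pi} \<inter> {a - e<..<a + e}) > 0"
proof -
  \<comment> \<open>At an endpoint of the circle only one side of the neighbourhood remains, but it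
    still contains an interval of positive length.\<close>
  define l r where "l = max 0 (a - e / 2)" and "r = min (2 * pi) (a + e / 2)"
  have a: "0 \<le> a" "a \<le> 2 * pi" using assms(1) by simp_all
  have l: "0 \<le> l" "a - e < l" and r: "r \<le> 2 * pi" "r < a + e" and lr: "l < r"
    unfolding l_def r_def using a assms(2) pi_gt_zero by linarith+
  have sub: "{l..r} \<subseteq> {0..2*pi} \<inter> {a - e<..<a + e}"
    using l r by (intro subsetI) simp
  have "emeasure lborel {l..r} = ennreal (r - l)"
    by (rule emeasure_lborel_Icc) (use lr in linarith)
  then have "0 < emeasure lborel {l..r}" using lr by simp
  also have "\<dots> \<le> emeasure lborel ({0..2*pi} \<inter> {a - e<..<a + e})"
    by (rule emeasure_mono[OF sub]) simp
  also have "\<dots> = emeasure circle ({0..2*pi} \<inter> {a - e<..<a + e})"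
    by (rule emeasure_restrict_space[symmetric]) simp_all
  finally show ?thesis .
qed

lemma torus_box_pos:
  assumes x: "x \<in> space (torus d)" and e: "e > 0"
  shows "(\<Pi>\<^sub>E i\<in>{..<d}. {0..2*pi} \<inter> {x i - e<..<x i + e}) \<in> sets (torus d)"
    "measure (torus d) (\<Pi>\<^sub>E i\<in>{..<d}. {0..2*pi} \<inter> {x i - e<..<x i + e}) > 0"
proof -
  have s: "{0..2*pi} \<inter> {a - e<..<a + e} \<in> sets circle" for a :: real
    unfolding sets_restrict_space by (rule image_eqI[of _ _ "{a - e<..<a + e}"]) simp_all
  show m: "(\<Pi>\<^sub>E i\<in>{..<d}. {0..2*pi} \<inter> {x i - e<..<x i + e}) \<in> sets (torus d)"
    unfolding torus_def by (rule sets_PiM_I_finite) (simp_all add: s)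
  have "emeasure (torus d) (\<Pi>\<^sub>E i\<in>{..<d}. {0..2*pi} \<inter> {x i - e<..<x i + e})
      = (\<Prod>i<d. emeasure circle ({0..2*pi} \<inter> {x i - e<..<x i + e}))"
    unfolding torus_def by (rule circles.emeasure_PiM) (simp_all add: s)
  also have "\<dots> \<noteq> 0"
  proof -
    have "emeasure circle ({0..2*pi} \<inter> {x i - e<..<x i + e}) \<noteq> 0" if "i < d" for i
      using emeasure_circle_nbhd_pos[of "x i" e] x e PiE_mem[of x "{..<d}" "\<lambda>_. {0..2*pi}" i] that
      unfolding space_torus by auto
    then show ?thesis by (simp add: prod_zero_iff)
  qed
  finally show "measure (torus d) (\<Pi>\<^sub>E i\<in>{..<d}. {0..2*pi} \<inter> {x i - e<..<x i + e}) > 0"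
    by (simp add: torus.emeasure_eq_measure zero_less_measure_iff)
qed

theorem fourier_uniqueness:
  assumes cont: "torus_continuous d h" and h: "all_coeffs_zero d h" and x: "x \<in> space (torus d)"
  shows "h x = 0"
proof (rule ccontr)
  assume "h x \<noteq> 0"
  define \<delta> where "\<delta> = (cmod (h x))\<^sup>2"
  have \<delta>: "\<delta> > 0" using \<open>h x \<noteq> 0\<close> by (simp add: \<delta>_def)
  \<comment> \<open>The component of \<open>h\<close> in the direction of \<open>h x\<close>: it is
    real-valued, with \<open>u x = \<delta>\<close> positive.\<close>
  define u where "u t = Re (cnj (h x) * h t)" for t
  have hc: "continuous_on (space (torus d)) h" using cont by (simp add: torus_continuous_def)
  then have uc: "continuous_on (space (torus d)) u" unfolding u_def by (intro continuous_intros)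
  have inth: "integrable (torus d) h" using h by (simp add: all_coeffs_zero_def)
  have ui: "integrable (torus d) u" unfolding u_def using inth by (intro integrable_Re integrable_mult_right)
  \<comment> \<open>The compact set where \<open>u\<close> is not large. The bump equals 1 only at
    points identified with \<open>x\<close>, where \<open>u\<close> is \<delta>, so on this set it
    stays below some \<open>M < 1\<close>.\<close>
  define S where "S = space (torus d) \<inter> u -` {..\<delta>/2}"
  have "\<exists>M. 0 \<le> M \<and> M < 1 \<and> (\<forall>t\<in>S. torus_bump d x t \<le> M)"
  proof (cases "S = {}")
    case True
    then show ?thesis by (intro exI[of _ 0]) simp
  next
    case False
    have "compact S"
    proof -
      have cl: "closed (space (torus d))" by (rule compact_imp_closed[OF compact_torus])
      have "closed (u -` {..\<delta>/2} \<inter> space (torus d))"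
        using uc continuous_on_closed_vimage[OF cl, of u] closed_atMost by blast
      from compact_Int_closed[OF compact_torus[of d] this] show ?thesis
        unfolding S_def by (simp only: Int_commute Int_left_absorb)
    qed
    then obtain z where z: "z \<in> S" "\<forall>t\<in>S. torus_bump d x t \<le> torus_bump d x z"
      using continuous_attains_sup[OF _ False continuous_on_torus_bump] by blast
    have "torus_bump d x z \<noteq> 1"
    proof
      assume "torus_bump d x z = 1"
      have zs: "z \<in> space (torus d)" using z by (simp add: S_def)
      have "torus_eq d z x" by (rule torus_bump_eq_1[OF x zs]) fact
      then have "h z = h x" using cont zs x by (simp add: torus_continuous_def)
      then have "u z = \<delta>" by (simp add: u_def \<delta>_def cmod_power2) (simp add: power2_eq_square)
      then show False using z \<delta> by (simp add: S_def)
    qed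
    then have "torus_bump d x z < 1" using torus_bump_le_1[of d x z] by simp
    then show ?thesis using z torus_bump_nonneg[of d x z] by blast
  qed
  then obtain M where M: "0 \<le> M" "M < 1" "\<And>t. t \<in> S \<Longrightarrow> torus_bump d x t \<le> M" by blast
  \<comment> \<open>Chosen by Bernoulli's inequality so that \<open>\<rho> ^ d > M\<close>; the
    \<open>d + 1\<close> in the denominator covers dimension 0 as well.\<close>
  define \<rho> where "\<rho> = 1 - (1 - M) / (2 * (real d + 1))"
  have frac: "(1 - M) / (2 * (real d + 1)) \<le> 1 - M" "(1 - M) / (2 * (real d + 1)) > 0" "real d * ((1 - M) / (2 * (real d + 1))) < 1 - M"
  proof -
    define q where "q = (1 - M) / (2 * (real d + 1))"
    have "q > 0" using M by (simp add: q_def)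
    then have "real d * q \<ge> 0" by simp
    moreover have "q * (2 * (real d + 1)) = 1 - M" by (simp add: q_def)
    then have "2 * (real d * q) + 2 * q = 1 - M" by (simp add: algebra_simps)
    ultimately show "q \<le> 1 - M" "q > 0" "real d * q < 1 - M" using \<open>q > 0\<close> by linarith+
  qed
  have \<rho>: "\<rho> \<ge> 0" "\<rho> < 1" using frac M unfolding \<rho>_def by linarith+
  have "M < 1 + real d * (- ((1 - M) / (2 * (real d + 1))))" using frac by linarith
  also have "\<dots> \<le> (1 + (- ((1 - M) / (2 * (real d + 1))))) ^ d"
    by (rule Bernoulli_inequality) (use frac M in linarith)
  finally have M\<rho>: "M < \<rho> ^ d" by (simp add: \<rho>_def)
  have "((\<lambda>y::real. (1 + cos y) / 2) \<longlongrightarrow> (1 + cos 0) / 2) (at 0)"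
    by (intro tendsto_intros) simp
  then have "\<forall>\<^sub>F y in at 0. \<rho> < (1 + cos y) / 2"
    by (rule order_tendstoD(1)) (use \<rho> in simp)
  then obtain e where e0: "e > 0" "\<And>y::real. y \<noteq> 0 \<Longrightarrow> \<bar>y\<bar> < e \<Longrightarrow> \<rho> < (1 + cos y) / 2"
    unfolding eventually_at by (auto simp: dist_real_def)
  have e: "e > 0" "\<And>y. \<bar>y\<bar> < e \<Longrightarrow> \<rho> < (1 + cos y) / 2"
  proof -
    show "\<rho> < (1 + cos y) / 2" if "\<bar>y\<bar> < e" for y
      using e0(2)[of y] that \<rho> by (cases "y = 0") simp_all
  qed (rule e0(1))
  define V where "V = (\<Pi>\<^sub>E i\<in>{..<d}. {0..2*pi} \<inter> {x i - e<..<x i + e})"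
  have V: "V \<in> sets (torus d)" "measure (torus d) V > 0"
    unfolding V_def by (rule torus_box_pos[OF x e(1)])+
  have bumpV: "\<rho> ^ d \<le> torus_bump d x t" if "t \<in> V" for t
  proof -
    have "(\<Prod>i<d. \<rho>) \<le> (\<Prod>i<d. bump (x i) (t i))"
    proof (rule prod_mono)
      fix i assume "i \<in> {..<d}"
      then have "t i \<in> {0..2*pi} \<inter> {x i - e<..<x i + e}" using that unfolding V_def by (rule PiE_mem[rotated])
      then have "\<bar>t i - x i\<bar> < e" by auto
      from e(2)[OF this] show "0 \<le> \<rho> \<and> \<rho> \<le> bump (x i) (t i)" using \<rho> by (simp add: bump_def)
    qed
    then show ?thesis by (simp add: torus_bump_def)
  qed
  define I where "I = (LINT t|torus d. \<bar>u t\<bar>)"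
  \<comment> \<open>The integral of \<open>u\<close> against the \<open>n\<close>-th power of the
    bump is 0. Its integrand is at least \<open>(\<delta> / 2) * (\<rho> ^ d) ^ n\<close> on
    \<open>V\<close>, at least \<open>- (M ^ n * \<bar>u t\<bar>)\<close> on \<open>S\<close>, and
    nonnegative elsewhere; \<open>V\<close> misses \<open>S\<close> because the bump exceeds
    \<open>M\<close> there.\<close>
  have key: "(\<delta> / 2) * measure (torus d) V * (\<rho> ^ d) ^ n \<le> M ^ n * I" for n
  proof -
    have z: "all_coeffs_zero d (\<lambda>t. h t * complex_of_real (torus_bump d x t ^ n))"
      by (rule all_coeffs_zero_mult_torus_bump[OF h])
    then have int: "integrable (torus d) (\<lambda>t. h t * complex_of_real (torus_bump d x t ^ n))"
      by (simp add: all_coeffs_zero_def)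
    have "torus_char d (\<lambda>_. 0) t = 1" for t by (simp add: torus_char_def)
    then have 0: "(LINT t|torus d. h t * complex_of_real (torus_bump d x t ^ n)) = 0"
      using z unfolding all_coeffs_zero_def by (metis (no_types, lifting) Bochner_Integration.integral_cong mult_1_right)
    have eq: "u t * torus_bump d x t ^ n = Re (cnj (h x) * (h t * complex_of_real (torus_bump d x t ^ n)))" for t
      unfolding u_def mult.assoc[symmetric] by simp
    have i1: "integrable (torus d) (\<lambda>t. u t * torus_bump d x t ^ n)"
      unfolding eq by (intro integrable_Re integrable_mult_right int)
    have "(LINT t|torus d. u t * torus_bump d x t ^ n) = 0"
      unfolding eq using int 0 by (subst integral_Re) (auto intro: integrable_mult_right)
    moreover have "(LINT t|torus d. (\<delta> / 2) * (\<rho> ^ d) ^ n * indicator V t - M ^ n * \<bar>u t\<bar>) \<le> (LINT t|torus d. u t * torus_bump d x t ^ n)"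
    proof (rule integral_mono)
      show "integrable (torus d) (\<lambda>t. (\<delta> / 2) * (\<rho> ^ d) ^ n * indicator V t - M ^ n * \<bar>u t\<bar>)"
        using V ui by (intro Bochner_Integration.integrable_diff integrable_mult_right integrable_abs)
          (auto simp: torus.emeasure_finite less_top[symmetric] intro!: integrable_real_indicator)
      fix t assume t: "t \<in> space (torus d)"
      let ?P = "torus_bump d x t"
      show "(\<delta> / 2) * (\<rho> ^ d) ^ n * indicator V t - M ^ n * \<bar>u t\<bar> \<le> u t * ?P ^ n"
      proof (cases "u t \<le> \<delta> / 2")
        case True
        then have tS: "t \<in> S" using t by (simp add: S_def)
        then have "t \<notin> V" using bumpV[of t] M(3)[OF tS] M\<rho> by auto
        have "?P ^ n \<le> M ^ n" by (intro power_mono M(3) tS torus_bump_nonneg)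
        then have "\<bar>u t\<bar> * ?P ^ n \<le> \<bar>u t\<bar> * M ^ n" by (intro mult_left_mono) auto
        moreover have "- (\<bar>u t\<bar> * ?P ^ n) \<le> u t * ?P ^ n"
          using torus_bump_nonneg[of d x t] by (simp add: abs_if mult_nonneg_nonneg)
        ultimately show ?thesis using \<open>t \<notin> V\<close> by (simp add: mult.commute)
      next
        case False
        have "(\<delta> / 2) * (\<rho> ^ d) ^ n * indicator V t \<le> u t * ?P ^ n"
        proof (cases "t \<in> V")
          case True
          have "(\<rho> ^ d) ^ n \<le> ?P ^ n" using bumpV[OF True] \<rho> by (intro power_mono) auto
          then have "(\<delta> / 2) * (\<rho> ^ d) ^ n \<le> u t * ?P ^ n" using False \<delta> \<rho> by (intro mult_mono) auto
          then show ?thesis using True by simp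
        next
          case nV: False
          then show ?thesis using False \<delta> torus_bump_nonneg[of d x t] by simp
        qed
        moreover have "0 \<le> M ^ n * \<bar>u t\<bar>" using M by simp
        ultimately show ?thesis by linarith
      qed
    qed (rule i1)
    moreover have "(LINT t|torus d. (\<delta> / 2) * (\<rho> ^ d) ^ n * indicator V t - M ^ n * \<bar>u t\<bar>)
        = (\<delta> / 2) * (\<rho> ^ d) ^ n * measure (torus d) V - M ^ n * I"
    proof -
      have "V \<inter> space (torus d) = V" using sets.sets_into_space[OF V(1)] by blast
      then show ?thesis unfolding I_def
        using V ui by (subst Bochner_Integration.integral_diff)
          (auto simp: torus.emeasure_finite less_top[symmetric] intro!: integrable_real_indicator)
    qed
    ultimately show ?thesis by (simp add: mult_ac)
  qed
  \<comment> \<open>Dividing by \<open>(\<rho> ^ d) ^ n\<close> leaves a fixed positive number below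
    \<open>r ^ n * I\<close>, which tends to 0.\<close>
  define r where "r = M / \<rho> ^ d"
  have R: "\<rho> ^ d > 0" using M\<rho> M by linarith
  have r: "0 \<le> r" "r < 1" using M M\<rho> R by (simp_all add: r_def)
  have "(\<lambda>n. r ^ n * I) \<longlonglongrightarrow> 0 * I" by (intro tendsto_intros LIMSEQ_realpow_zero r)
  moreover have "(\<delta> / 2) * measure (torus d) V \<le> r ^ n * I" for n
    using key[of n] R by (simp add: r_def power_divide field_simps)
  ultimately have "(\<delta> / 2) * measure (torus d) V \<le> 0" by (intro LIMSEQ_le_const[of _ 0]) auto
  then show False using V \<delta> by (simp add: mult_le_0_iff)
qed

section \<open>Weighted norms and pointwise Fourier series\<close>

abbreviation freqs :: "nat \<Rightarrow> (nat \<Rightarrow> int) set" where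
  "freqs d \<equiv> {..<d} \<rightarrow>\<^sub>E UNIV"

lemma sum_freq_size_le:
  fixes b :: real
  assumes "b > 0"
  shows "\<exists>C>0. \<forall>K. finite K \<longrightarrow> K \<subseteq> freqs d \<longrightarrow> (\<Sum>k\<in>K. \<Prod>l<d. freq_size (k l) powr (-1 - b)) \<le> C"
proof -
  obtain C where C: "C > 0" "\<And>M j. (\<Sum>k=-int M..int M. freq_size k powr (-1-b) * level_active j k) \<le> C * (2 powr (-b)) ^ j"
    using sum_freq_active_le[OF assms] by blast
  \<comment> \<open>Every frequency is active at level 0, so the earlier bound at that level is a
    bound for the full sum.\<close>
  have act: "level_active 0 k = 1" for k
    using freq_size_ge_1[of k] by (simp add: level_active_def)
  have "(\<Sum>k\<in>K. \<Prod>l<d. freq_size (k l) powr (-1 - b)) \<le> C ^ d" if K: "finite K" "K \<subseteq> freqs d" for K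
  proof -
    obtain M where M: "K \<subseteq> {..<d} \<rightarrow>\<^sub>E {-int M..int M}" using finite_subset_cube[OF K] .
    have "(\<Sum>k\<in>K. \<Prod>l<d. freq_size (k l) powr (-1 - b))
        \<le> (\<Sum>k\<in>{..<d} \<rightarrow>\<^sub>E {-int M..int M}. \<Prod>l<d. freq_size (k l) powr (-1 - b))"
      using M by (intro sum_mono2) (simp_all add: finite_PiE prod_nonneg)
    also have "\<dots> = (\<Prod>l<d. \<Sum>k=-int M..int M. freq_size k powr (-1 - b))"
      by (rule prod_sum_PiE[symmetric]) simp_all
    also have "\<dots> \<le> (\<Prod>l<d. C)"
      using C(2)[of 0 M] by (intro prod_mono) (simp add: act sum_nonneg)
    finally show ?thesis by simp
  qed
  then show ?thesis using C by (intro exI[of _ "C ^ d"]) simp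
qed

text \<open>With \<open>s = a + 1/2\<close> the left-hand side is
  \<open>freq_size k powr (2 * s)\<close>, a lower bound shared by the weights of both
  norms.\<close>

definition heavy_weight :: "(real \<Rightarrow> int \<Rightarrow> real) \<Rightarrow> real \<Rightarrow> real \<Rightarrow> bool" where
  "heavy_weight w s a \<longleftrightarrow> (\<forall>k. freq_size k powr (1 + 2 * a) \<le> w s k)"

lemma heavy_weight_mix:
  assumes "w \<in> {mix_weight_abs, mix_weight_sq}" "a > -1/2"
  shows "heavy_weight w (a + 1/2) a"
  unfolding heavy_weight_def
proof
  fix k
  have e: "2 * (a + 1/2) = 1 + 2 * a" by simp
  have "freq_size k \<le> 1 + \<bar>real_of_int k\<bar>" by (simp add: freq_size_def)
  then have 1: "freq_size k powr (1 + 2 * a) \<le> mix_weight_abs (a + 1/2) k"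
    unfolding mix_weight_abs_def e using assms(2) less_imp_le[OF freq_size_pos] by (intro powr_mono2) simp_all
  have "(freq_size k)\<^sup>2 \<le> 1 + \<bar>real_of_int k\<bar>\<^sup>2"
    by (simp add: freq_size_def max_def)
  then have "((freq_size k)\<^sup>2) powr (a + 1/2) \<le> mix_weight_sq (a + 1/2) k"
    unfolding mix_weight_sq_def using assms(2) by (intro powr_mono2) simp_all
  moreover have "((freq_size k)\<^sup>2) powr (a + 1/2) = freq_size k powr (1 + 2 * a)"
    using powr_powr[of "freq_size k" 2 "a + 1/2"] freq_size_pos[of k] by (simp add: e add.commute)
  ultimately show "freq_size k powr (1 + 2 * a) \<le> w (a + 1/2) k"
    using 1 assms(1) by auto
qed

lemma Hmix_norm_nonneg:
  assumes "heavy_weight w s a"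
  shows "0 \<le> Hmix_norm w d s f"
proof -
  have "0 \<le> w s k" for k
    using assms order_trans[OF powr_ge_zero] unfolding heavy_weight_def by blast
  then have "0 \<le> Hmix_term w d s f k" for k
    unfolding Hmix_term_def by (intro mult_nonneg_nonneg prod_nonneg) simp_all
  then show ?thesis
    unfolding Hmix_norm_def by (intro real_sqrt_ge_zero infsum_nonneg)
qed

text \<open>Cauchy-Schwarz against the weight. The factor \<open>b\<close> is left free: it is
  constantly 1 for absolute convergence, and the error on the exponentials for the recovery
  bound.\<close>

lemma weighted_coeff_sum_le:
  assumes w: "heavy_weight w s a" and f: "f \<in> Hmix w d s" and K: "finite K" "K \<subseteq> freqs d"
  shows "(\<Sum>k\<in>K. cmod (fourier_coeff d f k) * b k)
    \<le> Hmix_norm w d s f * sqrt (\<Sum>k\<in>K. (\<Prod>l<d. freq_size (k l) powr (-1 - 2 * a)) * (b k)\<^sup>2)"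
proof -
  define W where "W k = (\<Prod>l<d. w s (k l))" for k
  define c where "c k = cmod (fourier_coeff d f k)" for k
  have wpos: "0 < freq_size i powr (1 + 2 * a)" "freq_size i powr (1 + 2 * a) \<le> w s i" for i
    using w by (simp_all add: heavy_weight_def less_imp_neq[OF freq_size_pos, symmetric])
  then have wp: "0 < w s i" for i by (meson less_le_trans)
  have W: "W k > 0" for k unfolding W_def by (intro prod_pos) (simp add: wp)
  have Winv: "1 / W k \<le> (\<Prod>l<d. freq_size (k l) powr (-1 - 2 * a))" for k
  proof -
    have "1 / W k = (\<Prod>l<d. inverse (w s (k l)))"
      unfolding W_def by (simp add: prod_inversef[symmetric] o_def divide_inverse)
    also have "\<dots> \<le> (\<Prod>l<d. freq_size (k l) powr (-1 - 2 * a))"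
    proof (rule prod_mono)
      fix l
      have "inverse (w s (k l)) \<le> inverse (freq_size (k l) powr (1 + 2 * a))"
        by (rule le_imp_inverse_le) (use wpos in simp_all)
      also have "\<dots> = freq_size (k l) powr (- (1 + 2 * a))" by (simp only: powr_minus)
      also have "- (1 + 2 * a) = -1 - 2 * a" by simp
      finally show "0 \<le> inverse (w s (k l)) \<and> inverse (w s (k l)) \<le> freq_size (k l) powr (-1 - 2 * a)"
        using wp[of "k l"] by simp
    qed
    finally show ?thesis .
  qed
  have summ: "Hmix_term w d s f summable_on freqs d" using f by (simp add: Hmix_def)
  have Hterm: "Hmix_term w d s f k = (c k)\<^sup>2 * W k" for k by (simp add: Hmix_term_def c_def W_def)
  have part: "(\<Sum>k\<in>K. (c k)\<^sup>2 * W k) \<le> (Hmix_norm w d s f)\<^sup>2"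
  proof -
    have nn: "0 \<le> Hmix_term w d s f k" for k using W[of k] by (simp add: Hterm)
    have "sum (Hmix_term w d s f) K \<le> infsum (Hmix_term w d s f) (freqs d)"
      by (rule finite_sum_le_infsum[OF summ K]) (rule nn)
    also have "\<dots> = (Hmix_norm w d s f)\<^sup>2"
      unfolding Hmix_norm_def by (rule real_sqrt_pow2[symmetric]) (rule infsum_nonneg[OF nn])
    finally show ?thesis by (simp add: Hterm)
  qed
  have nonneg: "0 \<le> Hmix_norm w d s f" by (rule Hmix_norm_nonneg[OF w])
  have "(\<Sum>k\<in>K. c k * b k)\<^sup>2 = (\<Sum>k\<in>K. (c k * sqrt (W k)) * (b k / sqrt (W k)))\<^sup>2"
    by (intro arg_cong[of _ _ "\<lambda>x. x\<^sup>2"] sum.cong refl) (simp add: less_imp_neq[OF W, symmetric])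
  also have "\<dots> \<le> (\<Sum>k\<in>K. (c k * sqrt (W k))\<^sup>2) * (\<Sum>k\<in>K. (b k / sqrt (W k))\<^sup>2)"
    by (rule Cauchy_Schwarz_ineq_sum)
  also have "\<dots> = (\<Sum>k\<in>K. (c k)\<^sup>2 * W k) * (\<Sum>k\<in>K. (1 / W k) * (b k)\<^sup>2)"
    by (simp add: power_mult_distrib power_divide less_imp_le[OF W])
  also have "\<dots> \<le> (Hmix_norm w d s f)\<^sup>2 * (\<Sum>k\<in>K. (\<Prod>l<d. freq_size (k l) powr (-1 - 2 * a)) * (b k)\<^sup>2)"
    by (intro mult_mono part sum_mono mult_right_mono Winv sum_nonneg)
      (simp_all add: less_imp_le[OF W])
  finally have "sqrt ((\<Sum>k\<in>K. c k * b k)\<^sup>2)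
    \<le> sqrt ((Hmix_norm w d s f)\<^sup>2 * (\<Sum>k\<in>K. (\<Prod>l<d. freq_size (k l) powr (-1 - 2 * a)) * (b k)\<^sup>2))"
    by (rule real_sqrt_le_mono)
  then have "\<bar>\<Sum>k\<in>K. c k * b k\<bar> \<le> Hmix_norm w d s f * sqrt (\<Sum>k\<in>K. (\<Prod>l<d. freq_size (k l) powr (-1 - 2 * a)) * (b k)\<^sup>2)"
    using nonneg by (simp add: real_sqrt_mult)
  then show ?thesis unfolding c_def by linarith
qed

lemma fourier_coeffs_abs_summable:
  assumes w: "heavy_weight w s a" and a: "a > 0" and f: "f \<in> Hmix w d s"
  shows "(\<lambda>k. norm (fourier_coeff d f k)) summable_on freqs d"
proof -
  obtain C where C: "\<And>K. finite K \<Longrightarrow> K \<subseteq> freqs d \<Longrightarrow> (\<Sum>k\<in>K. \<Prod>l<d. freq_size (k l) powr (-1 - 2 * a)) \<le> C"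
    using sum_freq_size_le[of "2 * a" d] a by auto
  have nonneg: "0 \<le> Hmix_norm w d s f" by (rule Hmix_norm_nonneg[OF w])
  have "(\<Sum>k\<in>K. norm (fourier_coeff d f k)) \<le> Hmix_norm w d s f * sqrt C"
    if K: "finite K" "K \<subseteq> freqs d" for K
  proof -
    have "(\<Sum>k\<in>K. norm (fourier_coeff d f k)) \<le> Hmix_norm w d s f * sqrt (\<Sum>k\<in>K. \<Prod>l<d. freq_size (k l) powr (-1 - 2 * a))"
      using weighted_coeff_sum_le[OF w f K, of "\<lambda>_. 1"] by simp
    also have "\<dots> \<le> Hmix_norm w d s f * sqrt C"
      by (intro mult_left_mono real_sqrt_le_mono C K nonneg)
    finally show ?thesis .
  qed
  then show ?thesis by (intro nonneg_bdd_above_summable_on bdd_aboveI2) auto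
qed

lemma uniform_limit_finite_subsetsD:
  fixes S :: "'b set \<Rightarrow> 'a \<Rightarrow> 'c::real_normed_vector"
  assumes "uniform_limit X S g (finite_subsets_at_top A)" "e > 0" "finite K0" "K0 \<subseteq> A"
  shows "\<exists>K. finite K \<and> K \<subseteq> A \<and> K0 \<subseteq> K \<and> (\<forall>x\<in>X. norm (g x - S K x) < e)"
proof -
  have "\<forall>\<^sub>F Z in finite_subsets_at_top A. \<forall>x\<in>X. dist (S Z x) (g x) < e"
    by (rule uniform_limitD[OF assms(1,2)])
  then obtain Y where Y: "finite Y" "Y \<subseteq> A"
    and close: "\<forall>Z. finite Z \<and> Y \<subseteq> Z \<and> Z \<subseteq> A \<longrightarrow> (\<forall>x\<in>X. dist (S Z x) (g x) < e)"
    unfolding eventually_finite_subsets_at_top by (elim exE conjE) (rule that)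
  show ?thesis
  proof (intro exI conjI ballI)
    show fin: "finite (Y \<union> K0)" and sub: "Y \<union> K0 \<subseteq> A" and "K0 \<subseteq> Y \<union> K0"
      using Y assms(3,4) by simp_all
    fix x assume "x \<in> X"
    then have "dist (S (Y \<union> K0) x) (g x) < e" using close fin sub by simp
    then show "norm (g x - S (Y \<union> K0) x) < e" unfolding dist_norm by (subst norm_minus_commute)
  qed
qed

text \<open>The series converges uniformly to a continuous \<open>g\<close> with the same
  coefficients as \<open>f\<close>, and uniqueness gives \<open>f = g\<close> at every point, as
  sampling requires.\<close>

lemma fourier_series:
  assumes f: "f \<in> L2_torus d" "torus_continuous d f"
    and summ: "(\<lambda>k. norm (fourier_coeff d f k)) summable_on freqs d" and x: "x \<in> space (torus d)"
  shows "((\<lambda>k. fourier_coeff d f k * torus_char d k x) has_sum f x) (freqs d)"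
proof -
  define c where "c = fourier_coeff d f"
  define S where "S K x = (\<Sum>k\<in>K. c k * torus_char d k x)" for K x
  define g where "g x = (\<Sum>\<^sub>\<infinity>k\<in>freqs d. c k * torus_char d k x)" for x
  have nc: "norm (c k * torus_char d k x) = norm (c k)" for k x by (simp add: norm_mult)
  have sm: "(\<lambda>k. norm (c k)) summable_on freqs d" using summ by (simp add: c_def)
  have ul: "uniform_limit (space (torus d)) S g (finite_subsets_at_top (freqs d))"
    unfolding S_def g_def by (rule Weierstrass_m_test_general[OF _ sm]) (simp only: nc order_refl)
  note approx = uniform_limit_finite_subsetsD[OF ul]
  have Sc: "continuous_on A (S K)" for A K
    unfolding S_def[abs_def] by (intro continuous_on_sum continuous_on_mult continuous_on_const continuous_on_torus_char)
  have gc: "continuous_on (space (torus d)) g"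
    by (rule uniform_limit_theorem[OF _ ul]) (simp_all add: Sc)
  have Sm: "S K \<in> borel_measurable (torus d)" for K
    unfolding S_def[abs_def] by (intro borel_measurable_sum borel_measurable_times borel_measurable_const measurable_torus_char)
  have gm: "g \<in> borel_measurable (torus d)"
  proof -
    \<comment> \<open>Convergence is along the net of finite sets, while measurability passes to
      limits of sequences; so a sequence of finite sets with errors \<open>1 / real (Suc n)\<close>
      is picked.\<close>
    have "\<forall>n. \<exists>K. \<forall>x\<in>space (torus d). norm (g x - S K x) < 1 / real (Suc n)"
    proof
      fix n
      have "1 / real (Suc n) > 0" by simp
      from approx[OF this finite.emptyI empty_subsetI]
      show "\<exists>K. \<forall>x\<in>space (torus d). norm (g x - S K x) < 1 / real (Suc n)" by blast
    qed
    then obtain F where F: "\<And>n x. x \<in> space (torus d) \<Longrightarrow> norm (g x - S (F n) x) < 1 / real (Suc n)"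
      by metis
    show ?thesis
    proof (rule borel_measurable_LIMSEQ_metric[of "\<lambda>n. S (F n)"])
      fix x assume x: "x \<in> space (torus d)"
      have "(\<lambda>n. g x - S (F n) x) \<longlonglongrightarrow> 0"
      proof (rule Lim_null_comparison)
        show "\<forall>\<^sub>F n in sequentially. norm (g x - S (F n) x) \<le> 1 / real (Suc n)"
          by (intro always_eventually allI less_imp_le F x)
        show "(\<lambda>n. 1 / real (Suc n)) \<longlonglongrightarrow> 0" by (rule LIMSEQ_Suc[OF lim_1_over_n])
      qed
      then have "(\<lambda>n. g x - (g x - S (F n) x)) \<longlonglongrightarrow> g x - 0" by (intro tendsto_intros)
      then show "(\<lambda>n. S (F n) x) \<longlonglongrightarrow> g x" by simp
    qed (rule Sm)
  qed
  have gb: "norm (g x) \<le> (\<Sum>\<^sub>\<infinity>k\<in>freqs d. norm (c k))" for x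
  proof -
    have "norm (g x) \<le> (\<Sum>\<^sub>\<infinity>k\<in>freqs d. norm (c k * torus_char d k x))"
      unfolding g_def by (rule norm_infsum_bound) (simp only: nc sm)
    then show ?thesis by (simp only: nc)
  qed
  have gi: "integrable (torus d) g"
    by (rule torus.integrable_const_bound[OF AE_I2 gm]) (rule gb)
  have fi: "integrable (torus d) f"
  proof (rule Bochner_Integration.integrable_bound[of _ "\<lambda>x. 1 + (cmod (f x))\<^sup>2"])
    show "integrable (torus d) (\<lambda>x. 1 + (cmod (f x))\<^sup>2)"
      using f(1) by (intro Bochner_Integration.integrable_add) (simp_all add: L2_torus_def)
    show "f \<in> borel_measurable (torus d)" using f(1) by (simp add: L2_torus_def)
    have le: "y \<le> 1 + y\<^sup>2" for y :: real
    proof -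
      have "(y - 1)\<^sup>2 = y\<^sup>2 - 2 * y + 1" by (simp add: power2_eq_square algebra_simps)
      moreover have "0 \<le> (y - 1)\<^sup>2" "0 \<le> y\<^sup>2" by simp_all
      ultimately show ?thesis by linarith
    qed
    show "AE x in torus d. norm (f x) \<le> norm (1 + (cmod (f x))\<^sup>2)"
    proof (rule AE_I2)
      fix x show "norm (f x) \<le> norm (1 + (cmod (f x))\<^sup>2)" using le[of "cmod (f x)"] by simp
    qed
  qed
  have zero: "all_coeffs_zero d (\<lambda>x. f x - g x)"
    unfolding all_coeffs_zero_def
  proof (intro conjI allI)
    show "integrable (torus d) (\<lambda>x. f x - g x)" by (rule Bochner_Integration.integrable_diff[OF fi gi])
    fix k :: "nat \<Rightarrow> int"
    \<comment> \<open>The integral against \<open>torus_char d k\<close> is the coefficient of the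
      opposite frequency. The restriction puts it into \<open>freqs d\<close>, since
      \<open>k\<close> is arbitrary outside \<open>{..<d}\<close>.\<close>
    define l where "l = restrict (\<lambda>i. - k i) {..<d}"
    have lA: "l \<in> freqs d" by (simp add: l_def)
    let ?J = "LINT x|torus d. (f x - g x) * torus_char d k x"
    have "norm ?J \<le> e" if "e > 0" for e
    proof -
      have "e / (2 * pi) ^ d > 0" using that by simp
      then obtain K where K: "finite K" "K \<subseteq> freqs d" "{l} \<subseteq> K"
        "\<And>x. x \<in> space (torus d) \<Longrightarrow> norm (g x - S K x) < e / (2 * pi) ^ d"
        using approx[of "e / (2 * pi) ^ d" "{l}"] finite.emptyI finite.insertI lA by (metis empty_subsetI insert_subset)
      have Si: "integrable (torus d) (S K)"
        unfolding S_def[abs_def] using integrable_mult_torus_char[of d "\<lambda>_. 1"]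
        by (intro Bochner_Integration.integrable_sum integrable_mult_right) simp
      have i1: "integrable (torus d) (\<lambda>x. f x * torus_char d k x)"
        by (rule integrable_mult_torus_char[OF fi])
      have i2: "integrable (torus d) (\<lambda>x. S K x * torus_char d k x)"
        by (rule integrable_mult_torus_char[OF Si])
      have i3: "integrable (torus d) (\<lambda>x. (g x - S K x) * torus_char d k x)"
        by (intro integrable_mult_torus_char Bochner_Integration.integrable_diff gi Si)
      have fk: "(LINT x|torus d. f x * torus_char d k x) = c l * (2 * pi) ^ d"
      proof -
        have "torus_char d (\<lambda>i. - l i) = torus_char d k"
          by (simp add: torus_char_def l_def fun_eq_iff)
        then show ?thesis by (simp add: c_def fourier_coeff_torus_char)
      qed
      have Sk: "(LINT x|torus d. S K x * torus_char d k x) = c l * (2 * pi) ^ d"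
      proof -
        have "(LINT x|torus d. S K x * torus_char d k x)
            = (LINT x|torus d. (\<Sum>m\<in>K. c m * torus_char d (\<lambda>i. m i + k i) x))"
          by (simp only: S_def sum_distrib_right mult.assoc torus_char_mult)
        also have "\<dots> = (\<Sum>m\<in>K. c m * (LINT x|torus d. torus_char d (\<lambda>i. m i + k i) x))"
        proof -
          have "integrable (torus d) (torus_char d m)" for m
            using integrable_mult_torus_char[of d "\<lambda>_. 1" m] by simp
          then show ?thesis
            by (subst Bochner_Integration.integral_sum) (simp_all only: integrable_mult_right integral_mult_right_zero)
        qed
        also have "\<dots> = (\<Sum>m\<in>K. if m = l then c m * (2 * pi) ^ d else 0)"
        proof (intro sum.cong refl)
          fix m assume "m \<in> K"
          then have m: "m \<in> extensional {..<d}" using K(2) unfolding PiE_def by blast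
          have "(\<forall>i<d. m i + k i = 0) \<longleftrightarrow> m = l"
          proof
            assume *: "\<forall>i<d. m i + k i = 0"
            have "m i = l i" if "i \<in> {..<d}" for i using * that by (simp add: l_def eq_neg_iff_add_eq_0)
            then show "m = l" by (intro extensionalityI[OF m]) (simp_all add: l_def)
          qed (simp add: l_def)
          then show "c m * (LINT x|torus d. torus_char d (\<lambda>i. m i + k i) x) = (if m = l then c m * (2 * pi) ^ d else 0)"
            by (simp add: integral_torus_char)
        qed
        also have "\<dots> = c l * (2 * pi) ^ d" using K by simp
        finally show ?thesis .
      qed
      have "?J = (LINT x|torus d. f x * torus_char d k x - S K x * torus_char d k x - (g x - S K x) * torus_char d k x)"
        by (intro Bochner_Integration.integral_cong refl) (simp add: algebra_simps)
      also have "\<dots> = (LINT x|torus d. f x * torus_char d k x) - (LINT x|torus d. S K x * torus_char d k x)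
          - (LINT x|torus d. (g x - S K x) * torus_char d k x)"
        by (simp only: Bochner_Integration.integral_diff Bochner_Integration.integrable_diff i1 i2 i3)
      finally have "norm ?J = norm (LINT x|torus d. (g x - S K x) * torus_char d k x)"
        by (simp add: fk Sk)
      also have "\<dots> \<le> (LINT x|torus d. norm ((g x - S K x) * torus_char d k x))"
        by (rule integral_norm_bound)
      also have "\<dots> \<le> (LINT x|torus d. e / (2 * pi) ^ d)"
        using K(4) by (intro integral_mono integrable_norm i3) (simp_all add: norm_mult less_imp_le)
      also have "\<dots> = e" by (simp add: measure_torus)
      finally show ?thesis .
    qed
    then have "norm ?J \<le> 0" by (rule field_le_epsilon[of _ 0, simplified])
    then show "?J = 0" by simp
  qed
  have "torus_continuous d (\<lambda>x. f x - g x)"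
    unfolding torus_continuous_def
  proof (intro conjI ballI impI)
    show "continuous_on (space (torus d)) (\<lambda>x. f x - g x)"
      using f(2) gc unfolding torus_continuous_def by (intro continuous_on_diff) simp_all
    fix x y assume "x \<in> space (torus d)" "y \<in> space (torus d)" "torus_eq d x y"
    then show "f x - g x = f y - g y"
      using f(2) torus_char_torus_eq[of d x y] by (simp add: torus_continuous_def g_def)
  qed
  from fourier_uniqueness[OF this zero x] have "f x = g x" by simp
  moreover have "(\<lambda>k. c k * torus_char d k x) summable_on freqs d"
    by (rule abs_summable_summable) (simp only: nc sm)
  ultimately show ?thesis unfolding g_def c_def by (simp add: has_sum_infsum)
qed

section \<open>The uniform recovery error and the sampling numbers\<close>

lemma has_sum_sum_finite:
  fixes F :: "'p \<Rightarrow> 'a \<Rightarrow> 'b::topological_comm_monoid_add"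
  assumes "finite P" "\<And>p. p \<in> P \<Longrightarrow> (F p has_sum S p) A"
  shows "((\<lambda>k. \<Sum>p\<in>P. F p k) has_sum (\<Sum>p\<in>P. S p)) A"
  using assms
proof (induction P rule: finite_induct)
  case empty
  then show ?case by simp
next
  case (insert p P)
  then have "((\<lambda>k. F p k + (\<Sum>p\<in>P. F p k)) has_sum (S p + (\<Sum>p\<in>P. S p))) A"
    by (intro has_sum_add) simp_all
  then show ?case using insert.hyps by simp
qed

lemma grid_node_in_torus:
  assumes "p \<in> grid_index d L"
  shows "grid_node d p \<in> space (torus d)"
  unfolding space_torus grid_node_def
proof (rule restrict_PiE_iff[THEN iffD2], rule ballI)
  fix l assume l: "l \<in> {..<d}"
  obtain j i where p: "p = (j, i)" by fastforce
  then have "i \<in> (\<Pi>\<^sub>E l\<in>{..<d}. {..<2 ^ j l})" using assms unfolding grid_index_def by blast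
  from PiE_mem[OF this l] have "i l < 2 ^ j l" by simp
  then have "real (i l) \<le> 2 ^ j l" by (metis less_imp_le of_nat_le_iff of_nat_numeral of_nat_power)
  then have "real (i l) / 2 ^ j l \<le> 1" by simp
  then have "2 * pi * (real (i l) / 2 ^ j l) \<le> 2 * pi * 1" by (intro mult_left_mono) simp_all
  then show "2 * pi * real (snd p l) / 2 ^ fst p l \<in> {0..2 * pi}" using p by simp
qed

text \<open>The operator is a finite combination of point values, each of which is a Fourier series,
  so it acts term by term and the error is the series of coefficients times errors on
  exponentials.\<close>

lemma smolyak_error_le:
  assumes w: "heavy_weight w s a" and a: "a > 0" and f: "f \<in> Hmix w d s" "Hmix_norm w d s f \<le> 1"
    and t: "t \<in> space (torus d)"
    and B: "\<And>K. finite K \<Longrightarrow> K \<subseteq> freqs d \<Longrightarrow>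
      (\<Sum>k\<in>K. (\<Prod>l<d. freq_size (k l) powr (-1 - 2 * a)) *
         (norm (torus_char d k t - smolyak d L (torus_char d k) t))\<^sup>2) \<le> B"
  shows "norm (f t - smolyak d L f t) \<le> sqrt B"
proof -
  define c where "c = fourier_coeff d f"
  define E where "E k = torus_char d k t - smolyak d L (torus_char d k) t" for k
  have fL: "f \<in> L2_torus d" "torus_continuous d f" using f(1) by (simp_all add: Hmix_def)
  have ser: "((\<lambda>k. c k * torus_char d k x) has_sum f x) (freqs d)" if "x \<in> space (torus d)" for x
    unfolding c_def by (rule fourier_series[OF fL fourier_coeffs_abs_summable[OF w a f(1)] that])
  have "((\<lambda>k. \<Sum>p\<in>grid_index d L. c k * torus_char d k (grid_node d p) * grid_fun d p t) has_sum
      (\<Sum>p\<in>grid_index d L. f (grid_node d p) * grid_fun d p t)) (freqs d)"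
    by (intro has_sum_sum_finite has_sum_cmult_left ser grid_node_in_torus) simp_all
  then have "((\<lambda>k. c k * smolyak d L (torus_char d k) t) has_sum smolyak d L f t) (freqs d)"
    unfolding smolyak_def by (simp only: sum_distrib_left mult.assoc)
  then have "((\<lambda>k. - (c k * smolyak d L (torus_char d k) t)) has_sum - smolyak d L f t) (freqs d)"
    by (simp add: has_sum_uminus)
  from has_sum_add[OF ser[OF t] this]
  have sum: "((\<lambda>k. c k * E k) has_sum (f t - smolyak d L f t)) (freqs d)"
    by (simp add: E_def right_diff_distrib)
  have part: "(\<Sum>k\<in>K. norm (c k * E k)) \<le> sqrt B" if K: "finite K" "K \<subseteq> freqs d" for K
  proof -
    have "(\<Sum>k\<in>K. norm (c k * E k)) = (\<Sum>k\<in>K. cmod (fourier_coeff d f k) * norm (E k))"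
      by (simp add: norm_mult c_def)
    also have "\<dots> \<le> Hmix_norm w d s f * sqrt (\<Sum>k\<in>K. (\<Prod>l<d. freq_size (k l) powr (-1 - 2 * a)) * (norm (E k))\<^sup>2)"
      by (rule weighted_coeff_sum_le[OF w f(1) K])
    also have "\<dots> \<le> 1 * sqrt B"
      using B[OF K] by (intro mult_mono f(2) real_sqrt_le_mono real_sqrt_ge_zero sum_nonneg)
        (simp_all add: E_def prod_nonneg)
    finally show ?thesis by simp
  qed
  have sm: "(\<lambda>k. norm (c k * E k)) summable_on freqs d"
    by (rule nonneg_bdd_above_summable_on) (use part in \<open>auto intro!: bdd_aboveI2\<close>)
  have "norm (f t - smolyak d L f t) \<le> infsum (\<lambda>k. norm (c k * E k)) (freqs d)"
    by (rule norm_has_sum_bound[OF has_sum_infsum[OF sm] sum])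
  also have "\<dots> \<le> sqrt B" by (rule infsum_le_finite_sums[OF sm part])
  finally show ?thesis .
qed

lemma continuous_on_grid_fun: "continuous_on S (grid_fun d p)"
proof -
  have "continuous_on S (\<lambda>t. node_fun j i (t l))" for j i l
    by (rule continuous_on_compose2[OF continuous_node_fun continuous_on_coord subset_UNIV])
  then show ?thesis unfolding grid_fun_def[abs_def] by (intro continuous_on_prod)
qed

lemma measurable_grid_fun: "grid_fun d p \<in> borel_measurable (torus d)"
proof -
  have "(\<lambda>t. node_fun j i (t l)) \<in> borel_measurable (torus d)" if "l < d" for j i l
    by (rule measurable_compose[OF measurable_torus_coord[OF that] borel_measurable_continuous_onI[OF continuous_node_fun]])
  then show ?thesis unfolding grid_fun_def[abs_def] by (intro borel_measurable_prod) simp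
qed

lemma Linf_norm_le:
  assumes "f \<in> borel_measurable (torus d)" "\<And>t. t \<in> space (torus d) \<Longrightarrow> norm (f t) \<le> B"
  shows "Linf_norm d f \<le> ennreal B"
  unfolding Linf_norm_def
proof (rule esssup_I)
  show "(\<lambda>x. ennreal (cmod (f x))) \<in> borel_measurable (torus d)"
    using assms(1) by measurable
  show "AE x in torus d. ennreal (cmod (f x)) \<le> ennreal B"
    by (intro AE_I2 ennreal_leI assms(2))
qed

lemma sampling_number_le:
  assumes w: "heavy_weight w s a" and a: "a > 0" and n: "card (grid_index d L) \<le> n"
    and B: "\<And>t K. finite K \<Longrightarrow> K \<subseteq> freqs d \<Longrightarrow>
      (\<Sum>k\<in>K. (\<Prod>l<d. freq_size (k l) powr (-1 - 2 * a)) *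
         (norm (torus_char d k t - smolyak d L (torus_char d k) t))\<^sup>2) \<le> B"
  shows "sampling_number_Linf d (Hmix w d s) (Hmix_norm w d s) n \<le> ennreal (sqrt B)"
proof -
  define N where "N = card (grid_index d L)"
  obtain h where h: "bij_betw h {..<N} (grid_index d L)"
    unfolding N_def using ex_bij_betw_nat_finite[of "grid_index d L"] by (auto simp: atLeast0LessThan)
  \<comment> \<open>Surplus sample points are put at the origin and ignored by \<open>R\<close>, so
    any \<open>n\<close> at least as large as the grid is admissible.\<close>
  define X where "X i = (if i < N then grid_node d (h i) else restrict (\<lambda>_. 0) {..<d})" for i
  define R where "R v t = (\<Sum>i<N. v i * grid_fun d (h i) t)" for v t
  have Xs: "X i \<in> space (torus d)" for i
  proof (cases "i < N")
    case True
    then have "h i \<in> grid_index d L" using h by (metis bij_betwE lessThan_iff)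
    then show ?thesis using True by (simp add: X_def grid_node_in_torus)
  next
    case False
    then show ?thesis by (simp add: X_def space_torus restrict_PiE_iff)
  qed
  have Rm: "R v \<in> borel_measurable (torus d)" for v
    unfolding R_def[abs_def]
    by (intro borel_measurable_sum borel_measurable_times borel_measurable_const measurable_grid_fun)
  have RL: "R v \<in> Linf_torus d" for v
  proof -
    have "continuous_on (space (torus d)) (R v)"
      unfolding R_def[abs_def] by (intro continuous_on_sum continuous_on_mult continuous_on_const continuous_on_grid_fun)
    then have "bounded (R v ` space (torus d))"
      by (intro compact_imp_bounded compact_continuous_image compact_torus)
    then obtain b where "\<And>t. t \<in> space (torus d) \<Longrightarrow> norm (R v t) \<le> b"
      unfolding bounded_iff by blast
    then have "Linf_norm d (R v) \<le> ennreal b" by (rule Linf_norm_le[OF Rm])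
    also have "\<dots> < \<infinity>" by simp
    finally show ?thesis using Rm by (simp add: Linf_torus_def)
  qed
  have lin: "linear_to_Linf d n R"
    unfolding linear_to_Linf_def
  proof (intro conjI ballI allI AE_I2)
    show "R (\<lambda>i. u i + v i) t = R u t + R v t" for u v t
      by (simp add: R_def distrib_right sum.distrib)
    show "R (\<lambda>i. a * v i) t = a * R v t" for a v t
      by (simp add: R_def sum_distrib_left mult.assoc)
  qed (rule RL)
  have Rs: "R (sample n X f) t = smolyak d L f t" for f t
  proof -
    have "R (sample n X f) t = (\<Sum>i<N. f (grid_node d (h i)) * grid_fun d (h i) t)"
      unfolding R_def using n by (intro sum.cong refl) (simp add: sample_def X_def N_def)
    also have "\<dots> = smolyak d L f t"
      unfolding smolyak_def by (rule sum.reindex_bij_betw[OF h, of "\<lambda>p. f (grid_node d p) * grid_fun d p t"])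
    finally show ?thesis .
  qed
  have err: "Linf_norm d (\<lambda>t. f t - R (sample n X f) t) \<le> ennreal (sqrt B)"
    if f: "f \<in> Hmix w d s" "Hmix_norm w d s f \<le> 1" for f
  proof (rule Linf_norm_le)
    have "f \<in> borel_measurable (torus d)" using f(1) by (simp add: Hmix_def L2_torus_def)
    then show "(\<lambda>t. f t - R (sample n X f) t) \<in> borel_measurable (torus d)"
      by (intro borel_measurable_diff Rm)
    fix t assume "t \<in> space (torus d)"
    then show "norm (f t - R (sample n X f) t) \<le> sqrt B"
      unfolding Rs by (intro smolyak_error_le[OF w a f] B)
  qed
  show ?thesis
    unfolding sampling_number_Linf_def
  proof (rule INF_lower2[of X], goal_cases)
    case 1
    then show ?case using Xs by simp
  next
    case 2
    show ?case
    proof (rule INF_lower2[of R], goal_cases)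
      case 1
      then show ?case using lin by simp
    next
      case 2
      show ?case by (rule SUP_least) (use err in simp)
    qed
  qed
qed

section \<open>Choice of the level and the final rates\<close>

lemma ex_level_for_budget:
  fixes m e :: nat
  assumes "m \<ge> 2"
  shows "\<exists>L. (L + 1) ^ e * 2 ^ (L + 1) \<le> m \<and> m < (L + 2) ^ e * 2 ^ (L + 2)"
proof -
  define P where "P L \<longleftrightarrow> m < (L + 1) ^ e * 2 ^ (L + 1)" for L
  have "P m"
  proof -
    have "m < 1 * 2 ^ (m + 1)" using less_exp[of "m + 1"] by simp
    also have "\<dots> \<le> (m + 1) ^ e * 2 ^ (m + 1)" by (intro mult_right_mono) simp_all
    finally show ?thesis by (simp add: P_def)
  qed
  define k where "k = (LEAST L. P L)"
  have Pk: "P k" unfolding k_def by (rule LeastI[of P, OF \<open>P m\<close>])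
  \<comment> \<open>At level 0 the cost bound is 2, which is where \<open>m \<ge> 2\<close>
    enters.\<close>
  have "\<not> P 0" using assms by (simp add: P_def)
  then obtain L where L: "k = Suc L" using Pk by (cases k) auto
  have "\<not> P L" unfolding not_def by (intro impI) (use not_less_Least[of L P] L k_def in simp)
  then show ?thesis using Pk L by (intro exI[of _ L]) (simp add: P_def not_less)
qed

lemma ln_2_ge_half: "1 / 2 \<le> ln (2::real)"
  using ln_le_minus_one[of "1 / 2 :: real"] by (simp add: ln_div)

text \<open>With \<open>x = L + 2\<close> and \<open>e = d - 1\<close>, the budget condition gives \<open>2 ^ L > m / (4 * x ^ e)\<close> and
  \<open>x \<le> (2 / ln 2) * ln m\<close>, which turns the error of level \<open>L\<close> into a rate in \<open>m\<close>.\<close>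

lemma budget_rate:
  fixes m e L :: nat and a :: real
  assumes m: "m \<ge> 2" and a: "a > 0"
    and L: "(L + 1) ^ e * 2 ^ (L + 1) \<le> m" "m < (L + 2) ^ e * 2 ^ (L + 2)"
  shows "sqrt ((real L + 1) ^ e * (2 powr (- 2 * a)) ^ L)
    \<le> 4 powr a * (2 / ln 2) powr ((a + 1/2) * real e) * (real m powr (- a) * ln (real m) powr ((a + 1/2) * real e))"
proof -
  define x where "x = real L + 2"
  define y where "y = x ^ e"
  have x: "x > 0" by (simp add: x_def)
  have y: "y > 0" using x by (simp add: y_def)
  have mpos: "real m > 0" using m by simp
  have sq: "sqrt ((2 powr (- 2 * a)) ^ L) = (2 ^ L) powr (- a)"
  proof -
    have "(2 powr (- 2 * a)) ^ L = (2 powr (- 2 * a)) powr real L" by (subst powr_realpow) simp_all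
    also have "\<dots> = (2 powr real L) powr (- 2 * a)" by (simp only: powr_powr mult.commute)
    also have "\<dots> = (2 ^ L) powr (- a + - a)" by (simp add: powr_realpow)
    also have "\<dots> = ((2 ^ L) powr (- a))\<^sup>2" unfolding powr_add power2_eq_square ..
    finally show ?thesis by simp
  qed
  have "real m < real ((L + 2) ^ e * 2 ^ (L + 2))" using L(2) by (simp only: of_nat_less_iff)
  also have "\<dots> = y * (4 * 2 ^ L)" by (simp add: y_def x_def add.commute)
  finally have "real m / (4 * y) \<le> 2 ^ L" using y by (simp add: field_simps)
  then have "(2 ^ L) powr (- a) \<le> (real m / (4 * y)) powr (- a)"
    using a mpos y by (intro powr_mono2') simp_all
  also have "\<dots> = real m powr (- a) * (4 powr a * y powr a)"
  proof -
    have "(real m / (4 * y)) powr (- a) = real m powr (- a) / (4 * y) powr (- a)" by (rule powr_divide)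
    also have "\<dots> = real m powr (- a) * (4 * y) powr a" by (simp add: powr_minus divide_inverse)
    finally show ?thesis by (simp add: powr_mult)
  qed
  finally have p2: "(2 ^ L) powr (- a) \<le> real m powr (- a) * (4 powr a * y powr a)" .
  have "(real L + 1) ^ e \<le> y" unfolding y_def x_def by (intro power_mono) simp_all
  then have p1: "sqrt ((real L + 1) ^ e) \<le> y powr (1/2)"
    using y by (simp add: powr_half_sqrt)
  have "y powr (1/2) * y powr a = x powr ((a + 1/2) * real e)"
  proof -
    have "y powr (1/2) * y powr a = y powr (a + 1/2)" by (simp add: powr_add mult.commute)
    also have "\<dots> = (x powr real e) powr (a + 1/2)" using x by (simp add: y_def powr_realpow)
    finally show ?thesis by (simp only: powr_powr mult.commute)
  qed
  moreover have "x powr ((a + 1/2) * real e) \<le> (2 / ln 2 * ln (real m)) powr ((a + 1/2) * real e)"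
  proof (rule powr_mono2)
    have "(2::nat) ^ (L + 1) \<le> (L + 1) ^ e * 2 ^ (L + 1)" by simp
    then have "real (2 ^ (L + 1)) \<le> real m" using L(1) by (simp only: of_nat_le_iff)
    then have "2 ^ (L + 1) \<le> real m" by simp
    then have "ln (2 ^ (L + 1)) \<le> ln (real m)" using mpos by (simp only: ln_le_cancel_iff zero_less_power zero_less_numeral)
    then have "real (L + 1) * ln 2 \<le> ln (real m)" by (simp only: ln_realpow zero_less_numeral)
    then have "(real L + 1) * ln 2 \<le> ln (real m)" by (simp add: add.commute)
    then have "real L + 1 \<le> ln (real m) / ln 2" by (simp add: field_simps)
    \<comment> \<open>The 2 in the constant comes from
      \<open>L + 2 \<le> 2 * (L + 1)\<close>.\<close>
    then have "x \<le> 2 * (ln (real m) / ln 2)" unfolding x_def by linarith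
    then show "x \<le> 2 / ln 2 * ln (real m)" by simp
  qed (use a x in simp_all)
  ultimately have p3: "y powr (1/2) * y powr a \<le> (2 / ln 2) powr ((a + 1/2) * real e) * ln (real m) powr ((a + 1/2) * real e)"
    by (simp only: powr_mult)
  have "sqrt ((real L + 1) ^ e * (2 powr (- 2 * a)) ^ L) = sqrt ((real L + 1) ^ e) * (2 ^ L) powr (- a)"
    by (simp only: real_sqrt_mult sq)
  also have "\<dots> \<le> y powr (1/2) * (real m powr (- a) * (4 powr a * y powr a))"
    by (intro mult_mono p1 p2) simp_all
  also have "\<dots> = 4 powr a * real m powr (- a) * (y powr (1/2) * y powr a)" by (simp only: mult_ac)
  also have "\<dots> \<le> 4 powr a * real m powr (- a) * ((2 / ln 2) powr ((a + 1/2) * real e) * ln (real m) powr ((a + 1/2) * real e))"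
    by (intro mult_left_mono p3) simp_all
  finally show ?thesis by (simp only: mult_ac)
qed

text \<open>Any number \<open>n \<ge> m\<close> of samples is allowed while the rate is expressed in
  \<open>m\<close>, so that both claims are instances with the same constant.\<close>

lemma sampling_number_rate:
  assumes d: "d \<ge> 1" and s: "s > 1/2" and w: "w \<in> {mix_weight_abs, mix_weight_sq}"
  shows "\<exists>C>0. \<forall>m n. 2 \<le> m \<longrightarrow> m \<le> n \<longrightarrow>
    sampling_number_Linf d (Hmix w d s) (Hmix_norm w d s) n
      \<le> ennreal (C * real m powr (- s + 1/2) * ln (real m) powr (s * (real d - 1)))"
proof -
  define a where "a = s - 1/2"
  have a: "a > 0" using s by (simp add: a_def)
  have sa: "s = a + 1/2" by (simp add: a_def)
  have hw: "heavy_weight w s a" unfolding sa by (rule heavy_weight_mix[OF w]) (use a in simp)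
  obtain C0 where C0: "C0 > 0" "\<And>L t K. finite K \<Longrightarrow> K \<subseteq> freqs d \<Longrightarrow>
    (\<Sum>k\<in>K. (\<Prod>l<d. freq_size (k l) powr (-1 - 2 * a)) *
       (norm (torus_char d k t - smolyak d L (torus_char d k) t))\<^sup>2)
     \<le> C0 * (real L + 1) ^ (d - 1) * (2 powr (- 2 * a)) ^ L"
    using smolyak_error_square_sum_le[OF a d] by blast
  define Q where "Q = 4 powr a * (2 / ln 2) powr ((a + 1/2) * real (d - 1))"
  have Q: "Q > 0" by (simp add: Q_def)
  have "sampling_number_Linf d (Hmix w d s) (Hmix_norm w d s) n
      \<le> ennreal (sqrt C0 * Q * real m powr (- s + 1/2) * ln (real m) powr (s * (real d - 1)))"
    if m: "2 \<le> m" "m \<le> n" for m n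
  proof -
    obtain L where L: "(L + 1) ^ (d - 1) * 2 ^ (L + 1) \<le> m" "m < (L + 2) ^ (d - 1) * 2 ^ (L + 2)"
      using ex_level_for_budget[OF m(1)] by blast
    have "card (grid_index d L) \<le> n" using card_grid_index_le[OF d, of L] L(1) m(2) by linarith
    then have "sampling_number_Linf d (Hmix w d s) (Hmix_norm w d s) n
        \<le> ennreal (sqrt (C0 * (real L + 1) ^ (d - 1) * (2 powr (- 2 * a)) ^ L))"
      by (rule sampling_number_le[OF hw a]) (rule C0(2))
    also have "\<dots> \<le> ennreal (sqrt C0 * Q * real m powr (- s + 1/2) * ln (real m) powr (s * (real d - 1)))"
    proof (rule ennreal_leI)
      have "sqrt (C0 * (real L + 1) ^ (d - 1) * (2 powr (- 2 * a)) ^ L)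
          = sqrt C0 * sqrt ((real L + 1) ^ (d - 1) * (2 powr (- 2 * a)) ^ L)"
        by (simp only: real_sqrt_mult mult.assoc)
      also have "\<dots> \<le> sqrt C0 * (Q * (real m powr (- a) * ln (real m) powr ((a + 1/2) * real (d - 1))))"
        unfolding Q_def using C0(1) by (intro mult_left_mono budget_rate m a L) simp_all
      also have "\<dots> = sqrt C0 * Q * real m powr (- s + 1/2) * ln (real m) powr (s * (real d - 1))"
        using d by (simp add: sa of_nat_diff mult.assoc)
      finally show "sqrt (C0 * (real L + 1) ^ (d - 1) * (2 powr (- 2 * a)) ^ L)
        \<le> sqrt C0 * Q * real m powr (- s + 1/2) * ln (real m) powr (s * (real d - 1))" .
    qed
    finally show ?thesis .
  qed
  moreover have "sqrt C0 * Q > 0" using C0 Q by simp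
  ultimately show ?thesis by blast
qed

theorem theorem7p5:
  "\<exists>b c :: real. b > 0 \<and> c > 0 \<and>
     (\<forall>(d::nat) (s::real). \<forall>w \<in> {mix_weight_abs, mix_weight_sq}. d \<ge> 1 \<and> s > 1/2 \<longrightarrow>
        (\<exists>C::real. C > 0 \<and> (\<forall>m::nat. m \<ge> 2 \<longrightarrow>
           sampling_number_Linf d (Hmix w d s) (Hmix_norm w d s) (nat \<lfloor>b * real m * ln (real m)\<rfloor>)
             \<le> ennreal (C * real m powr (- s + 1/2) * ln (real m) powr (s * (real d - 1))))) \<and>
        (\<exists>C::real. C > 0 \<and> (\<forall>n::nat. n \<ge> 2 \<longrightarrow>
           sampling_number_Linf d (Hmix w d s) (Hmix_norm w d s) (nat \<lfloor>c * real n\<rfloor>)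
             \<le> ennreal (C * real n powr (- s + 1/2) * ln (real n) powr (s * (real d - 1) + 1/2)))))"
proof (rule exI[of _ 2], rule exI[of _ 1], intro conjI allI ballI impI)
  fix d :: nat and s :: real and w :: "real \<Rightarrow> int \<Rightarrow> real"
  assume w: "w \<in> {mix_weight_abs, mix_weight_sq}" and "d \<ge> 1 \<and> s > 1/2"
  then have d: "d \<ge> 1" and s: "s > 1/2" by simp_all
  obtain C where C: "C > 0" "\<And>m n. 2 \<le> m \<Longrightarrow> m \<le> n \<Longrightarrow>
    sampling_number_Linf d (Hmix w d s) (Hmix_norm w d s) n
      \<le> ennreal (C * real m powr (- s + 1/2) * ln (real m) powr (s * (real d - 1)))"
    using sampling_number_rate[OF d s w] by blast
  show "\<exists>C::real. C > 0 \<and> (\<forall>m::nat. m \<ge> 2 \<longrightarrow>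
           sampling_number_Linf d (Hmix w d s) (Hmix_norm w d s) (nat \<lfloor>2 * real m * ln (real m)\<rfloor>)
             \<le> ennreal (C * real m powr (- s + 1/2) * ln (real m) powr (s * (real d - 1))))"
  proof (intro exI[of _ C] conjI allI impI)
    fix m :: nat assume m: "m \<ge> 2"
    have "1 / 2 \<le> ln (real m)" using ln_2_ge_half ln_mono[of 2 "real m"] m by linarith
    then have "2 * real m * (1 / 2) \<le> 2 * real m * ln (real m)" by (intro mult_left_mono) simp_all
    then have "m \<le> nat \<lfloor>2 * real m * ln (real m)\<rfloor>" by (simp add: le_nat_floor)
    then show "sampling_number_Linf d (Hmix w d s) (Hmix_norm w d s) (nat \<lfloor>2 * real m * ln (real m)\<rfloor>)
      \<le> ennreal (C * real m powr (- s + 1/2) * ln (real m) powr (s * (real d - 1)))"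
      by (rule C(2)[OF m])
  qed (rule C(1))
  show "\<exists>C::real. C > 0 \<and> (\<forall>n::nat. n \<ge> 2 \<longrightarrow>
           sampling_number_Linf d (Hmix w d s) (Hmix_norm w d s) (nat \<lfloor>1 * real n\<rfloor>)
             \<le> ennreal (C * real n powr (- s + 1/2) * ln (real n) powr (s * (real d - 1) + 1/2)))"
  \<comment> \<open>For \<open>n = 2\<close> the logarithm is below 1 and the extra factor
    \<open>ln n powr (1/2)\<close> would shrink the bound; \<open>ln 2 powr (-(1/2))\<close>
    compensates for this for all \<open>n \<ge> 2\<close>.\<close>
  proof (intro exI[of _ "C * ln 2 powr (-(1/2))"] conjI allI impI)
    show "C * ln 2 powr (-(1/2)) > 0" using C(1) by simp
    fix n :: nat assume n: "n \<ge> 2"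
    have pos: "ln (2::real) > 0" by simp
    have "ln 2 \<le> ln (real n)" using n by simp
    then have "ln 2 powr (1/2) \<le> ln (real n) powr (1/2)" using pos by (intro powr_mono2) simp_all
    then have "ln 2 powr (-(1/2)) * ln 2 powr (1/2) \<le> ln 2 powr (-(1/2)) * ln (real n) powr (1/2)"
      by (intro mult_left_mono) simp_all
    then have ge: "1 \<le> ln 2 powr (-(1/2)) * ln (real n) powr (1/2)"
      using pos by (simp flip: powr_add)
    have "sampling_number_Linf d (Hmix w d s) (Hmix_norm w d s) (nat \<lfloor>1 * real n\<rfloor>)
        \<le> ennreal (C * real n powr (- s + 1/2) * ln (real n) powr (s * (real d - 1)))"
      by (rule C(2)[OF n]) simp
    also have "\<dots> \<le> ennreal (C * ln 2 powr (-(1/2)) * real n powr (- s + 1/2) * ln (real n) powr (s * (real d - 1) + 1/2))"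
    proof (rule ennreal_leI)
      have "C * real n powr (- s + 1/2) * ln (real n) powr (s * (real d - 1)) * 1
        \<le> C * real n powr (- s + 1/2) * ln (real n) powr (s * (real d - 1)) * (ln 2 powr (-(1/2)) * ln (real n) powr (1/2))"
        using ge C(1) by (intro mult_left_mono) simp_all
      also have "\<dots> = C * ln 2 powr (-(1/2)) * real n powr (- s + 1/2) * ln (real n) powr (s * (real d - 1) + 1/2)"
        by (simp only: powr_add mult_ac)
      finally show "C * real n powr (- s + 1/2) * ln (real n) powr (s * (real d - 1))
        \<le> C * ln 2 powr (-(1/2)) * real n powr (- s + 1/2) * ln (real n) powr (s * (real d - 1) + 1/2)"
        by simp
    qed
    finally show "sampling_number_Linf d (Hmix w d s) (Hmix_norm w d s) (nat \<lfloor>1 * real n\<rfloor>)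
      \<le> ennreal (C * ln 2 powr (-(1/2)) * real n powr (- s + 1/2) * ln (real n) powr (s * (real d - 1) + 1/2))" .
  qed
qed simp_all

end
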